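(* Let $p$ be a prime, $q\in\mathbb{C}_p$ with $|q-1|_p<p^{-\frac{1}{p-1}}$, $\lambda\in\mathbb{C}_p\setminus\{0\}$, and $x\in\mathbb{Z}_p$. For every integer $n\ge0$, \[ \beta_{n,q}(x|\lambda)=\sum_{k=0}^n\sum_{l=0}^k\binom{n}{k}[x]_{n-k,\lambda}\lambda^{k-l}q^{lx}S_1(k,l)\beta_{l,q}, \] where $[x]_{m,\lambda}=[x]_q([x]_q-\lambda)\cdots([x]_q-(m-1)\lambda)$ (equal to $1$ for $m=0$).
   Context: $q^x=\exp(x\log q)$, $[x]_q=\frac{1-q^x}{1-q}$. The $p$-adic $q$-integral of a uniformly differentiable $f$ on $\mathbb{Z}_p$ is $\int_{\mathbb{Z}_p}f(y)\,d\mu_q(y)=\lim_{N\to\infty}\frac{1}{[p^N]_q}\sum_{y=0}^{p^N-1}f(y)q^y$. The Carlitz $q$-Bernoulli numbers are $\beta_{l,q}=\int_{\mathbb{Z}_p}[y]_q^l\,d\mu_q(y)$. For $t\in\mathbb{C}_p$ with $|\lambda t|_p<p^{-1/(p-1)}$, $(1+\lambda t)^{a/\lambda}=\exp(\frac{a}{\lambda}\log(1+\lambda t))$, and the degenerate Carlitz $q$-Bernoulli polynomials $\beta_{n,q}(x|\lambda)$ are defined by $\int_{\mathbb{Z}_p}(1+\lambda t)^{\frac{1}{\lambda}[x+y]_q}\,d\mu_q(y)=\sum_{n\ge0}\beta_{n,q}(x|\lambda)\frac{t^n}{n!}$. $S_1(k,l)$ are the (signed) Stirling numbers of the first kind: $x(x-1)\cdots(x-k+1)=\sum_{l=0}^kS_1(k,l)x^l$.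 *)

theory Defs
  imports "HOL-Analysis.Analysis" "HOL-Computational_Algebra.Polynomial"
begin

text \<open>
  The constant \<^const>\<open>norm\<close> is restricted to real normed vector spaces, so the absolute value
  has a name of its own. It induces the metric, hence the topology.
\<close>

class complete_nonarch_field = field_char_0 + complete_space +
  fixes absval :: "'a \<Rightarrow> real"
  assumes dist_absval: "dist x y = absval (x - y)"
    and absval_mult: "absval (x * y) = absval x * absval y"
    and absval_add: "absval (x + y) \<le> max (absval x) (absval y)"

text \<open>
  If \<open>absval (of_nat p) = 1 / p\<close>, the absolute value of \<open>'a\<close> restricts to the \<open>p\<close>-adic absolute value on \<open>\<rat>\<close>, and
  since \<open>'a\<close> is complete, the closure of \<open>\<rat>\<close> is then the completion \<open>\<rat>\<^sub>p\<close>.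
\<close>

definition padic_numbers :: "'a::complete_nonarch_field set" where
  "padic_numbers = closure \<rat>"

definition padic_integers :: "'a::complete_nonarch_field set" where
  "padic_integers = {x \<in> padic_numbers. absval x \<le> 1}"

definition padic_algebraic :: "'a::complete_nonarch_field set" where
  "padic_algebraic =
     {z. \<exists>f. f \<noteq> 0 \<and> (\<forall>i. poly.coeff f i \<in> padic_numbers) \<and> poly f z = 0}"

text \<open>
  \<open>'a\<close> is \<open>\<complex>\<^sub>p\<close>, the completion of an algebraic closure of \<open>\<rat>\<^sub>p\<close>: it is complete, and the
  elements algebraic over \<open>\<rat>\<^sub>p\<close> form an algebraically closed dense subset. This determines
  \<open>'a\<close> up to isometric field isomorphism.
\<close>

definition is_padic_complex :: "'a::complete_nonarch_field itself \<Rightarrow> nat \<Rightarrow> bool" where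
  "is_padic_complex T p \<longleftrightarrow>
     absval (of_nat p :: 'a) = 1 / real p \<and>
     (\<forall>f :: 'a poly. (\<forall>i. poly.coeff f i \<in> padic_algebraic) \<and> degree f > 0 \<longrightarrow>
        (\<exists>z\<in>padic_algebraic. poly f z = 0)) \<and>
     closure (padic_algebraic :: 'a set) = UNIV"

definition padic_exp :: "'a::complete_nonarch_field \<Rightarrow> 'a" where
  "padic_exp z = (\<Sum>n. z ^ n / fact n)"

definition padic_log :: "'a::complete_nonarch_field \<Rightarrow> 'a" where
  "padic_log w = (\<Sum>n. (-1) ^ n * (w - 1) ^ Suc n / of_nat (Suc n))"

definition padic_power :: "'a::complete_nonarch_field \<Rightarrow> 'a \<Rightarrow> 'a" where
  "padic_power q x = padic_exp (x * padic_log q)"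

text \<open>For \<open>q = 1\<close> the quotient is read as its limit \<open>x\<close> for \<open>q \<rightarrow> 1\<close>.\<close>

definition q_number :: "'a::complete_nonarch_field \<Rightarrow> 'a \<Rightarrow> 'a" where
  "q_number q x = (if q = 1 then x else (1 - padic_power q x) / (1 - q))"

definition q_integral :: "nat \<Rightarrow> 'a::complete_nonarch_field \<Rightarrow> ('a \<Rightarrow> 'a) \<Rightarrow> 'a" where
  "q_integral p q f =
     lim (\<lambda>N. 1 / q_number q (of_nat (p ^ N)) * (\<Sum>y<p ^ N. f (of_nat y) * q ^ y))"

definition carlitz_beta :: "nat \<Rightarrow> 'a::complete_nonarch_field \<Rightarrow> nat \<Rightarrow> 'a" where
  "carlitz_beta p q l = q_integral p q (\<lambda>y. q_number q y ^ l)"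

text \<open>\<open>(1 + \<lambda>t)\<^bsup>a/\<lambda>\<^esup>\<close>\<close>

definition degenerate_exp :: "'a::complete_nonarch_field \<Rightarrow> 'a \<Rightarrow> 'a \<Rightarrow> 'a" where
  "degenerate_exp lam a t = padic_exp (a / lam * padic_log (1 + lam * t))"

definition padic_exp_radius :: "nat \<Rightarrow> real" where
  "padic_exp_radius p = real p powr (- 1 / (real p - 1))"

text \<open>
  The sequence of coefficients of the generating function
  \<open>\<integral> (1 + \<lambda>t)\<^bsup>[x+y]/\<lambda>\<^esup> d\<mu>\<^sub>q(y) = (\<Sum>n. \<beta>\<^sub>n(x|\<lambda>) t\<^sup>n / n!)\<close>.
  The condition on \<open>\<lambda>t\<close> makes \<open>log (1 + \<lambda>t)\<close> have absolute value \<open>absval (\<lambda>t)\<close>; for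
  the exponential series at \<open>([x+y]/\<lambda>) log (1 + \<lambda>t)\<close> to converge for every \<open>y\<close>, the same
  bound is needed for \<open>t\<close>, because \<open>[x+y]\<close> may be a unit.
\<close>

definition degenerate_carlitz_beta ::
  "nat \<Rightarrow> 'a::complete_nonarch_field \<Rightarrow> 'a \<Rightarrow> nat \<Rightarrow> 'a \<Rightarrow> 'a" where
  "degenerate_carlitz_beta p q lam n x =
     (THE b. \<forall>t. absval (lam * t) < padic_exp_radius p \<and> absval t < padic_exp_radius p \<longrightarrow>
        (\<lambda>m. b m * t ^ m / fact m) sums
          q_integral p q (\<lambda>y. degenerate_exp lam (q_number q (x + y)) t)) n"

definition stirling1 :: "nat \<Rightarrow> nat \<Rightarrow> int" where
  "stirling1 k l = poly.coeff (\<Prod>i<k. [:- int i, 1:]) l"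

definition q_falling :: "'a::complete_nonarch_field \<Rightarrow> 'a \<Rightarrow> 'a \<Rightarrow> nat \<Rightarrow> 'a" where
  "q_falling q lam x m = (\<Prod>j<m. q_number q x - of_nat j * lam)"

end

theory Submission
  imports Defs "HOL-Computational_Algebra.Formal_Power_Series"
begin

text \<open>
  Write \<open>[y]\<close> for \<open>(1 - q\<^sup>y) / (1 - q)\<close> and \<open>(a)\<^sub>m\<close> for \<open>a (a - \<lambda>) \<dots> (a - (m - 1) \<lambda>)\<close>.
  The binomial series \<open>(1 + \<lambda>t)\<^bsup>a/\<lambda>\<^esup> = \<Sum>\<^sub>m (a)\<^sub>m t\<^sup>m / m!\<close> holds for \<open>|a| \<le> 1\<close>, because it holds for
  formal power series and the double series behind \<open>exp \<circ> log\<close> is dominated by a geometric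
  sequence. Hence \<open>\<beta>\<^sub>m(x|\<lambda>)\<close> is the integral of \<open>([x + y])\<^sub>m\<close>, provided that integral and sum
  may be exchanged. Substituting \<open>[x + y] = [x] + q\<^sup>x [y]\<close> and expanding \<open>(a + b)\<^sub>m\<close> by Vandermonde
  and \<open>(b)\<^sub>k\<close> by Stirling numbers then gives the formula.

  The exchange needs a bound on the means over \<open>{0..<p\<^sup>N}\<close> that is uniform in \<open>N\<close>. The functions
  \<open>P\<^sub>k(y) = \<Prod>\<^bsub>i<k\<^esub> ([y] - [i])\<close> satisfy \<open>[k + 1] \<Sum>\<^bsub>y<n\<^esub> P\<^sub>k(y) q\<^sup>y = P\<^bsub>k+1\<^esub>(n)\<close>, and \<open>[k + 1]\<close> has the
  absolute value of \<open>k + 1\<close>, so their means converge and are at most \<open>k + 1\<close>; a product of \<open>m\<close>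
  linear factors in \<open>[y]\<close> is a combination of \<open>P\<^sub>0, \<dots>, P\<^sub>m\<close>, and its means grow at most like
  \<open>(m + 1) R\<^sup>m\<close>. Everything works uniformly in \<open>q\<close>, including \<open>q = 1\<close>.
\<close>

unbundle no vec_syntax
unbundle fps_syntax

section \<open>Convergence over nonarchimedean fields\<close>

lemma absval_0 [simp]: "absval (0::'a::complete_nonarch_field) = 0"
  using dist_absval[of "0::'a" 0] by simp

lemma absval_nonneg [simp]: "0 \<le> absval (x::'a::complete_nonarch_field)"
  using dist_absval[of x 0] zero_le_dist[of x 0] by simp

lemma absval_eq_0_iff [simp]: "absval x = 0 \<longleftrightarrow> (x::'a::complete_nonarch_field) = 0"
  using dist_absval[of x 0] by (metis diff_zero dist_eq_0_iff)

lemma absval_pos_iff [simp]: "0 < absval x \<longleftrightarrow> (x::'a::complete_nonarch_field) \<noteq> 0"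
  by (simp add: less_le)

lemma absval_1 [simp]: "absval (1::'a::complete_nonarch_field) = 1"
  using absval_mult[of "1::'a" 1] by simp

lemma absval_minus [simp]: "absval (- x) = absval (x::'a::complete_nonarch_field)"
  using dist_absval[of x 0] dist_absval[of 0 x] by (simp add: dist_commute)

lemma absval_minus_commute: "absval (x - y) = absval (y - x::'a::complete_nonarch_field)"
  by (metis absval_minus minus_diff_eq)

lemma absval_diff: "absval (x - y) \<le> max (absval x) (absval (y::'a::complete_nonarch_field))"
  using absval_add[of x "- y"] by simp

lemma absval_add_le:
  "absval x \<le> B \<Longrightarrow> absval y \<le> B \<Longrightarrow> absval (x + y::'a::complete_nonarch_field) \<le> B"
  using absval_add[of x y] by simp

lemma absval_diff_le:
  "absval x \<le> B \<Longrightarrow> absval y \<le> B \<Longrightarrow> absval (x - y::'a::complete_nonarch_field) \<le> B"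
  using absval_diff[of x y] by simp

text \<open>Since \<open>x = (x + y) - y\<close>, an absolute value of \<open>x + y\<close> below
  that of \<open>x\<close> would contradict the ultrametric inequality.\<close>

lemma absval_add_dominant:
  fixes x y :: "'a::complete_nonarch_field"
  assumes "absval y < absval x"
  shows "absval (x + y) = absval x"
  using absval_add[of x y] absval_diff[of "x + y" y] assms by auto

lemma absval_power [simp]: "absval (x ^ n) = absval (x::'a::complete_nonarch_field) ^ n"
  by (induction n) (simp_all add: absval_mult)

lemma absval_inverse [simp]: "absval (inverse x) = inverse (absval (x::'a::complete_nonarch_field))"
proof (cases "x = 0")
  case False
  then have "absval x * absval (inverse x) = 1"
    by (simp flip: absval_mult)
  then show ?thesis
    by (metis inverse_unique)
qed simp

lemma absval_divide: "absval (x / y) = absval x / absval (y::'a::complete_nonarch_field)"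
  by (simp add: divide_inverse absval_mult)

lemma absval_sum_le:
  fixes f :: "'i \<Rightarrow> 'a::complete_nonarch_field"
  assumes "\<And>i. i \<in> A \<Longrightarrow> absval (f i) \<le> B" and "0 \<le> B"
  shows "absval (sum f A) \<le> B"
  using assms by (induction A rule: infinite_finite_induct) (auto intro: absval_add_le)

lemma absval_prod: "absval (prod f A) = (\<Prod>i\<in>A. absval (f i::'a::complete_nonarch_field))"
  by (induction A rule: infinite_finite_induct) (simp_all add: absval_mult)

lemma absval_of_nat_le_1 [simp]: "absval (of_nat n::'a::complete_nonarch_field) \<le> 1"
  by (induction n) (auto intro: absval_add_le)

lemma absval_of_int_le_1 [simp]: "absval (of_int n::'a::complete_nonarch_field) \<le> 1"
  by (cases n rule: int_cases2) simp_all

section \<open>Limits, continuity of the field operations, and unordered sums\<close>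

lemma tendsto_absval_iff:
  fixes f :: "'i \<Rightarrow> 'a::complete_nonarch_field"
  shows "(f \<longlongrightarrow> l) F \<longleftrightarrow> ((\<lambda>i. absval (f i - l)) \<longlongrightarrow> 0) F"
  by (subst tendsto_dist_iff) (simp add: dist_absval)

lemma absval_le_tendsto:
  fixes f :: "'i \<Rightarrow> 'a::complete_nonarch_field"
  assumes "(f \<longlongrightarrow> l) F" "F \<noteq> bot" "eventually (\<lambda>i. absval (f i) \<le> B) F"
  shows "absval l \<le> B"
proof -
  have "((\<lambda>i. dist (f i) 0) \<longlongrightarrow> dist l 0) F"
    by (intro tendsto_intros assms)
  then show ?thesis
    using assms(2,3) by (auto simp: dist_absval intro: tendsto_upperbound)
qed

instance complete_nonarch_field \<subseteq> topological_ab_group_add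
proof
  fix a b :: 'a
  show "((\<lambda>x. fst x + snd x) \<longlongrightarrow> a + b) (nhds a \<times>\<^sub>F nhds b)"
    unfolding tendsto_absval_iff
  proof (rule tendsto_sandwich[OF _ _ tendsto_const[of 0]])
    have "((\<lambda>x. dist (fst x) a) \<longlongrightarrow> dist a a) (nhds a \<times>\<^sub>F nhds b)"
      by (intro tendsto_intros filterlim_fst)
    moreover have "((\<lambda>x. dist (snd x) b) \<longlongrightarrow> dist b b) (nhds a \<times>\<^sub>F nhds b)"
      by (intro tendsto_intros filterlim_snd)
    ultimately show "((\<lambda>x. max (absval (fst x - a)) (absval (snd x - b))) \<longlongrightarrow> 0)
        (nhds a \<times>\<^sub>F nhds b)"
      using tendsto_max by (fastforce simp: dist_absval)
    show "\<forall>\<^sub>F x in nhds a \<times>\<^sub>F nhds b. absval (fst x + snd x - (a + b))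
        \<le> max (absval (fst x - a)) (absval (snd x - b))"
      by (intro always_eventually allI)
        (metis absval_add add_diff_add)
  qed auto
next
  fix a :: 'a
  show "(uminus \<longlongrightarrow> - a) (nhds a)"
    unfolding tendsto_absval_iff
    using tendsto_dist[OF filterlim_ident tendsto_const, of a a]
    by (simp add: dist_absval absval_minus_commute)
qed

instance complete_nonarch_field \<subseteq> topological_semigroup_mult
proof
  fix a b :: 'a
  show "((\<lambda>x. fst x * snd x) \<longlongrightarrow> a * b) (nhds a \<times>\<^sub>F nhds b)"
    unfolding tendsto_absval_iff
  proof (rule tendsto_sandwich[OF _ _ tendsto_const[of 0]])
    have fst: "((\<lambda>x. dist (fst x) a) \<longlongrightarrow> dist a a) (nhds a \<times>\<^sub>F nhds b)"
      by (intro tendsto_intros filterlim_fst)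
    have snd: "((\<lambda>x. dist (snd x) b) \<longlongrightarrow> dist b b) (nhds a \<times>\<^sub>F nhds b)"
      by (intro tendsto_intros filterlim_snd)
    have snd0: "((\<lambda>x. dist (snd x) 0) \<longlongrightarrow> dist b 0) (nhds a \<times>\<^sub>F nhds b)"
      by (intro tendsto_intros filterlim_snd)
    have "((\<lambda>x. dist (fst x) a * dist (snd x) 0 + absval a * dist (snd x) b)
      \<longlongrightarrow> dist a a * dist b 0 + absval a * dist b b) (nhds a \<times>\<^sub>F nhds b)"
      by (intro tendsto_add tendsto_mult tendsto_const fst snd snd0)
    then show "((\<lambda>x. absval (fst x - a) * absval (snd x) + absval a * absval (snd x - b)) \<longlongrightarrow> 0)
        (nhds a \<times>\<^sub>F nhds b)"
      by (simp add: dist_absval)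
    show "\<forall>\<^sub>F x in nhds a \<times>\<^sub>F nhds b. absval (fst x * snd x - a * b)
        \<le> absval (fst x - a) * absval (snd x) + absval a * absval (snd x - b)"
    proof (intro always_eventually allI)
      fix x :: "'a \<times> 'a"
      have "fst x * snd x - a * b = (fst x - a) * snd x + a * (snd x - b)"
        by (simp add: algebra_simps)
      then show "absval (fst x * snd x - a * b)
          \<le> absval (fst x - a) * absval (snd x) + absval a * absval (snd x - b)"
        using absval_add[of "(fst x - a) * snd x" "a * (snd x - b)"]
        by (smt (verit) absval_mult absval_nonneg)
    qed
  qed auto
qed

text \<open>By the ultrametric inequality, terms outside \<open>D n\<close> change a finite sum by
  at most \<open>(1/2) ^ n\<close>. Hence the sums over \<open>D n\<close> form a Cauchy sequence,
  and its limit is the sum of the family.\<close>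

lemma summable_on_null:
  fixes f :: "'i \<Rightarrow> 'a::complete_nonarch_field"
  assumes null: "\<And>e. e > 0 \<Longrightarrow> finite {i \<in> A. e \<le> absval (f i)}"
  shows "f summable_on A"
proof -
  define D where "D n = {i \<in> A. (1/2) ^ n \<le> absval (f i)}" for n :: nat
  have fin: "finite (D n)" and sub: "D n \<subseteq> A" for n
    using null[of "(1/2) ^ n"] by (auto simp: D_def)
  have near: "absval (sum f Y - sum f (D n)) \<le> (1/2) ^ n"
    if "finite Y" "D n \<subseteq> Y" "Y \<subseteq> A" for Y n
  proof -
    have "sum f Y - sum f (D n) = sum f (Y - D n)"
      using that by (simp add: sum_diff)
    also have "absval \<dots> \<le> (1/2) ^ n"
      using that by (intro absval_sum_le) (auto simp: D_def not_le less_imp_le)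
    finally show ?thesis .
  qed
  have mono: "D m \<subseteq> D n" if "m \<le> n" for m n
  proof -
    have "(1/2::real) ^ n \<le> (1/2) ^ m"
      using that by (intro power_decreasing) auto
    then show ?thesis
      unfolding D_def using order_trans[of "(1/2) ^ n"] by blast
  qed
  have half: "\<exists>n. (1/2::real) ^ n < e" if "e > 0" for e
    using that by (intro real_arch_pow_inv) auto
  have "Cauchy (\<lambda>n. sum f (D n))"
  proof (rule metric_CauchyI)
    fix e :: real assume "e > 0"
    then obtain n where n: "(1/2) ^ n < e" using half by blast
    have "dist (sum f (D i)) (sum f (D j)) < e" if "i \<ge> n" "j \<ge> n" for i j
    proof -
      have "absval ((sum f (D i) - sum f (D n)) - (sum f (D j) - sum f (D n))) \<le> (1/2) ^ n"
        using that by (intro absval_diff_le near fin sub mono)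
      then show ?thesis
        using n by (simp add: dist_absval)
    qed
    then show "\<exists>n. \<forall>i\<ge>n. \<forall>j\<ge>n. dist (sum f (D i)) (sum f (D j)) < e" by blast
  qed
  then obtain s where s: "(\<lambda>n. sum f (D n)) \<longlonglongrightarrow> s"
    using Cauchy_convergent convergent_def by blast
  have s_near: "absval (sum f (D n) - s) \<le> (1/2) ^ n" for n
  proof (rule absval_le_tendsto)
    show "(\<lambda>m. sum f (D n) - sum f (D m)) \<longlonglongrightarrow> sum f (D n) - s"
      by (intro tendsto_intros s)
    show "\<forall>\<^sub>F m in sequentially. absval (sum f (D n) - sum f (D m)) \<le> (1/2) ^ n"
      using eventually_ge_at_top[of n]
      by eventually_elim (simp add: absval_minus_commute[of "sum f (D n)"] near fin sub mono)
  qed auto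
  have "(f has_sum s) A"
    unfolding has_sum_def tendsto_iff eventually_finite_subsets_at_top
  proof (intro allI impI)
    fix e :: real assume "e > 0"
    then obtain n where n: "(1/2) ^ n < e" using half by blast
    have "dist (sum f Y) s < e" if "finite Y" "D n \<subseteq> Y" "Y \<subseteq> A" for Y
      using absval_add_le[OF near[OF that] s_near] n by (simp add: dist_absval)
    then show "\<exists>X. finite X \<and> X \<subseteq> A \<and> (\<forall>Y. finite Y \<and> X \<subseteq> Y \<and> Y \<subseteq> A \<longrightarrow> dist (sum f Y) s < e)"
      by (intro exI[of _ "D n"]) (simp add: fin sub)
  qed
  then show ?thesis by (auto simp: summable_on_def)
qed

lemma finite_ge_null_sequence:
  fixes g :: "nat \<Rightarrow> real"
  assumes "g \<longlonglongrightarrow> 0" "e > 0"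
  shows "finite {n. e \<le> g n}"
proof -
  have "eventually (\<lambda>n. g n < e) sequentially"
    using assms by (rule order_tendstoD)
  then obtain N where "\<And>n. n \<ge> N \<Longrightarrow> g n < e"
    by (auto simp: eventually_sequentially)
  then have "{n. e \<le> g n} \<subseteq> {..<N}"
    by (force simp: not_le)
  then show ?thesis
    using finite_subset by blast
qed

lemma summable_on_null_sequence:
  fixes f :: "nat \<Rightarrow> 'a::complete_nonarch_field"
  assumes "\<And>n. absval (f n) \<le> B n" "B \<longlonglongrightarrow> 0"
  shows "f summable_on UNIV"
proof (rule summable_on_null)
  fix e :: real assume "e > 0"
  then have "finite {n. e \<le> B n}"
    using assms by (intro finite_ge_null_sequence)
  then show "finite {n \<in> UNIV. e \<le> absval (f n)}"
    by (rule rev_finite_subset) (use assms(1) order_trans in auto)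
qed

lemma absval_has_sum_le:
  fixes f :: "'i \<Rightarrow> 'a::complete_nonarch_field"
  assumes "(f has_sum s) A" "\<And>i. i \<in> A \<Longrightarrow> absval (f i) \<le> B" "0 \<le> B"
  shows "absval s \<le> B"
  using assms unfolding has_sum_def
  by (intro absval_le_tendsto[of "sum f" s "finite_subsets_at_top A"]
      eventually_finite_subsets_at_top_weakI absval_sum_le) auto

text \<open>The products \<open>f i * g j\<close> form a null family over all pairs, hence a
  summable one. Summing by rows gives \<open>a * b\<close>, summing along antidiagonals gives the
  convolution.\<close>

lemma has_sum_Cauchy_product_nonarch:
  fixes f g :: "nat \<Rightarrow> 'a::complete_nonarch_field"
  assumes f: "(f has_sum a) UNIV" "(\<lambda>n. absval (f n)) \<longlonglongrightarrow> 0"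
    and g: "(g has_sum b) UNIV" "(\<lambda>n. absval (g n)) \<longlonglongrightarrow> 0"
  shows "((\<lambda>n. \<Sum>i=0..n. f i * g (n - i)) has_sum a * b) UNIV"
proof -
  obtain C where C: "C > 0" "\<And>n. absval (f n) \<le> C" "\<And>n. absval (g n) \<le> C"
  proof -
    obtain K L where "\<And>n. norm (absval (f n)) \<le> K" "\<And>n. norm (absval (g n)) \<le> L"
      using f(2) g(2) by (meson BseqE convergentI convergent_imp_Bseq)
    then show ?thesis
      by (intro that[of "max 1 (max K L)"]) (auto intro: max.coboundedI1 max.coboundedI2)
  qed
  have "(\<lambda>(i, j). f i * g j) summable_on UNIV \<times> UNIV"
  proof (rule summable_on_null)
    fix e :: real assume e: "e > 0"
    \<comment> \<open>\<open>C\<close> bounds both sequences, so a product of size at least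
      \<open>e\<close> forces each factor to be at least \<open>e / C\<close>; this leaves finitely
      many pairs.\<close>
    have "e / C \<le> absval (f i) \<and> e / C \<le> absval (g j)" if "e \<le> absval (f i) * absval (g j)" for i j
      using that C mult_left_mono[OF C(2)[of i], of "absval (g j)"]
        mult_left_mono[OF C(3)[of j], of "absval (f i)"]
      by (auto simp: divide_le_eq mult.commute)
    then have "{ij \<in> UNIV \<times> UNIV. e \<le> absval (case ij of (i, j) \<Rightarrow> f i * g j)}
        \<subseteq> {i. e / C \<le> absval (f i)} \<times> {j. e / C \<le> absval (g j)}"
      by (auto simp: absval_mult)
    moreover have "finite ({i. e / C \<le> absval (f i)} \<times> {j. e / C \<le> absval (g j)})"
      using e C(1) f(2) g(2) by (intro finite_cartesian_product finite_ge_null_sequence) auto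
    ultimately show "finite {ij \<in> UNIV \<times> UNIV. e \<le> absval (case ij of (i, j) \<Rightarrow> f i * g j)}"
      by (rule finite_subset)
  qed
  then obtain s where s: "((\<lambda>(i, j). f i * g j) has_sum s) (UNIV \<times> UNIV)"
    by (auto simp: summable_on_def)
  have "((\<lambda>i. f i * b) has_sum s) UNIV"
    using s by (rule has_sum_SigmaD) (use g(1) has_sum_cmult_right in auto)
  moreover have "((\<lambda>i. f i * b) has_sum a * b) UNIV"
    using f(1) by (rule has_sum_cmult_left)
  ultimately have "s = a * b"
    by (rule has_sum_unique)
  have "((\<lambda>(n, i). f i * g (n - i)) has_sum s) (SIGMA n:UNIV. {0..n})"
    using s
    by (subst has_sum_reindex_bij_witness[where j = "\<lambda>(n, i). (i, n - i)"
          and i = "\<lambda>(i, j). (i + j, i)"  and T = "UNIV \<times> UNIV"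
          and h = "\<lambda>(i, j). f i * g j" and s' = s]) auto
  then have "((\<lambda>n. \<Sum>i=0..n. f i * g (n - i)) has_sum s) UNIV"
    by (rule has_sum_SigmaD) (auto intro: has_sum_finite)
  then show ?thesis
    using \<open>s = a * b\<close> by simp
qed

section \<open>Powers and composition of convergent power series\<close>

lemma has_sum_fps_nth_power:
  fixes g :: "'a::complete_nonarch_field fps"
  assumes bound: "\<And>n. absval (g $ n * T ^ n) \<le> \<rho> * \<theta> ^ n" "0 \<le> \<rho>" "0 \<le> \<theta>" "\<theta> < 1"
    and g: "((\<lambda>n. g $ n * T ^ n) has_sum w) UNIV"
  shows "absval ((g ^ k) $ n * T ^ n) \<le> \<rho> ^ k * \<theta> ^ n"
    and "((\<lambda>n. (g ^ k) $ n * T ^ n) has_sum w ^ k) UNIV"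
proof -
  have null: "(\<lambda>n. absval (h n)) \<longlonglongrightarrow> 0" if "\<And>n. absval (h n) \<le> C * \<theta> ^ n" for C and h :: "nat \<Rightarrow> 'a"
    by (rule tendsto_sandwich[OF _ _ tendsto_const[of 0], where h = "\<lambda>n. C * \<theta> ^ n"])
      (use that assms(3,4) in \<open>auto intro!: tendsto_mult_right_zero LIMSEQ_realpow_zero\<close>)
  have "(\<forall>n. absval ((g ^ k) $ n * T ^ n) \<le> \<rho> ^ k * \<theta> ^ n) \<and>
      ((\<lambda>n. (g ^ k) $ n * T ^ n) has_sum w ^ k) UNIV"
  proof (induction k)
    case 0
    have "((\<lambda>n. (1 :: 'a fps) $ n * T ^ n) has_sum 1) UNIV"
      by (rule has_sum_finite_neutralI[where B = "{0}"]) auto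
    moreover have "absval ((1 :: 'a fps) $ n * T ^ n) \<le> \<theta> ^ n" for n
      using assms(3) by (cases n) auto
    ultimately show ?case by simp
  next
    case (Suc k)
    define f h where "f n = g $ n * T ^ n" and "h n = (g ^ k) $ n * T ^ n" for n
    have prod: "(g ^ Suc k) $ n * T ^ n = (\<Sum>i=0..n. f i * h (n - i))" for n
      unfolding power_Suc fps_mult_nth sum_distrib_right
    proof (rule sum.cong)
      fix i assume "i \<in> {0..n}"
      then have "T ^ n = T ^ i * T ^ (n - i)"
        by (simp flip: power_add)
      then show "g $ i * (g ^ k) $ (n - i) * T ^ n = f i * h (n - i)"
        by (simp add: f_def h_def)
    qed simp
    have "absval (f i * h (n - i)) \<le> \<rho> ^ Suc k * \<theta> ^ n" if "i \<le> n" for i n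
    proof -
      have "absval (f i) \<le> \<rho> * \<theta> ^ i" "absval (h (n - i)) \<le> \<rho> ^ k * \<theta> ^ (n - i)"
        using bound Suc by (simp_all only: f_def h_def)
      then have "absval (f i * h (n - i)) \<le> (\<rho> * \<theta> ^ i) * (\<rho> ^ k * \<theta> ^ (n - i))"
        unfolding absval_mult by (rule mult_mono) (use assms(2,3) in simp_all)
      also have "\<dots> = \<rho> ^ Suc k * \<theta> ^ (i + (n - i))"
        by (simp only: power_add power_Suc mult_ac)
      finally show ?thesis using that by simp
    qed
    \<comment> \<open>The ultrametric inequality bounds the convolution by its largest term, so no
      factor counting the \<open>n + 1\<close> summands appears.\<close>
    then have "\<forall>n. absval ((g ^ Suc k) $ n * T ^ n) \<le> \<rho> ^ Suc k * \<theta> ^ n"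
      unfolding prod using assms(2,3) by (auto intro!: absval_sum_le)
    moreover have "((\<lambda>n. \<Sum>i=0..n. f i * h (n - i)) has_sum w * w ^ k) UNIV"
      using Suc bound(1) by (intro has_sum_Cauchy_product_nonarch null[of f \<rho>] null[of h "\<rho> ^ k"])
        (auto simp: f_def h_def g)
    ultimately show ?case
      unfolding prod by simp
  qed
  then show "absval ((g ^ k) $ n * T ^ n) \<le> \<rho> ^ k * \<theta> ^ n"
    and "((\<lambda>n. (g ^ k) $ n * T ^ n) has_sum w ^ k) UNIV" by auto
qed

text \<open>The family \<open>f $ k * (g ^ k) $ n * T ^ n\<close> vanishes for \<open>n < k\<close>
  and is otherwise at most \<open>\<eta> ^ n\<close>, so it is summable over all pairs. Summing over
  \<open>n\<close> first gives the series of \<open>f\<close> at \<open>w\<close>, summing over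
  \<open>k\<close> first gives the composition.\<close>

lemma has_sum_fps_compose:
  fixes f g :: "'a::complete_nonarch_field fps"
  assumes g0: "g $ 0 = 0"
    and bound: "\<And>k n. k \<le> n \<Longrightarrow> absval (f $ k * (g ^ k) $ n * T ^ n) \<le> \<eta> ^ n" "0 \<le> \<eta>" "\<eta> < 1"
    and g: "\<And>k. ((\<lambda>n. (g ^ k) $ n * T ^ n) has_sum w ^ k) UNIV"
    and f: "((\<lambda>k. f $ k * w ^ k) has_sum s) UNIV"
  shows "((\<lambda>n. (f oo g) $ n * T ^ n) has_sum s) UNIV"
proof -
  define d where "d = (\<lambda>(k, n). f $ k * (g ^ k) $ n * T ^ n)"
  have d0: "d (k, n) = 0" if "n < k" for k n
    using startsby_zero_power_prefix[OF g0] that by (simp add: d_def)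
  have "d summable_on UNIV \<times> UNIV"
  proof (rule summable_on_null)
    fix e :: real assume "e > 0"
    then have "finite {n. e \<le> \<eta> ^ n}"
      using bound by (intro finite_ge_null_sequence LIMSEQ_realpow_zero) auto
    then have "finite (SIGMA n:{n. e \<le> \<eta> ^ n}. {..n})"
      by auto
    then have "finite (prod.swap ` (SIGMA n:{n. e \<le> \<eta> ^ n}. {..n}))"
      by (rule finite_imageI)
    moreover have "{x \<in> UNIV \<times> UNIV. e \<le> absval (d x)} \<subseteq> prod.swap ` (SIGMA n:{n. e \<le> \<eta> ^ n}. {..n})"
    proof clarify
      fix k n assume *: "e \<le> absval (d (k, n))"
      have "k \<le> n"
        using * d0[of n k] \<open>e > 0\<close> by (cases "n < k") auto
      moreover have "e \<le> \<eta> ^ n"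
        using * bound(1)[OF \<open>k \<le> n\<close>] by (simp add: d_def)
      ultimately show "(k, n) \<in> prod.swap ` (SIGMA n:{n. e \<le> \<eta> ^ n}. {..n})"
        by (auto intro!: image_eqI[of _ _ "(n, k)"])
    qed
    ultimately show "finite {x \<in> UNIV \<times> UNIV. e \<le> absval (d x)}"
      by (rule finite_subset[rotated])
  qed
  then obtain S where S: "(d has_sum S) (UNIV \<times> UNIV)"
    by (auto simp: summable_on_def)
  have "((\<lambda>k. f $ k * w ^ k) has_sum S) UNIV"
    using S
  proof (rule has_sum_SigmaD)
    fix k
    show "((\<lambda>n. d (k, n)) has_sum f $ k * w ^ k) UNIV"
      using has_sum_cmult_right[OF g[of k], of "f $ k"] by (simp add: d_def mult_ac)
  qed
  with f have "S = s"
    using has_sum_unique by blast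
  have "((\<lambda>(n, k). d (k, n)) has_sum S) (UNIV \<times> UNIV)"
    using S by (subst (asm) has_sum_swap)
  then have "((\<lambda>n. (f oo g) $ n * T ^ n) has_sum S) UNIV"
  proof (rule has_sum_SigmaD)
    fix n
    show "((\<lambda>k. (\<lambda>(n, k). d (k, n)) (n, k)) has_sum (f oo g) $ n * T ^ n) UNIV"
      by (rule has_sum_finite_neutralI[where B = "{0..n}"])
        (auto simp: d0, auto simp: d_def fps_compose_nth sum_distrib_right)
  qed
  then show ?thesis
    using \<open>S = s\<close> by simp
qed

text \<open>Both sides solve the differential equation \<open>F' = c F / (1 + X)\<close> with
  constant term 1, which has only one formal solution.\<close>

lemma fps_exp_compose_ln: "fps_exp c oo fps_ln 1 = fps_binomial (c::'a::field_char_0)"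
proof -
  have ln0: "fps_ln (1::'a) $ 0 = 0"
    by simp
  have "fps_deriv (fps_exp c oo fps_ln 1)
      = (fps_const c * fps_exp c oo fps_ln 1) * (fps_const (1/1) * inverse (1 + fps_X))"
    unfolding fps_compose_deriv[OF ln0] fps_ln_deriv fps_exp_deriv ..
  also have "(fps_const c * fps_exp c oo fps_ln 1) = fps_const c * (fps_exp c oo fps_ln 1)"
    unfolding fps_compose_mult_distrib[OF ln0] fps_const_compose ..
  also have "fps_const c * (fps_exp c oo fps_ln 1) * (fps_const (1/1) * inverse (1 + fps_X))
      = fps_const c * (fps_exp c oo fps_ln 1) / (1 + fps_X)"
    by (subst fps_divide_unit) auto
  finally show ?thesis
    by (subst fps_binomial_ODE_unique'[symmetric]) simp
qed

section \<open>The exponential, the logarithm and the binomial series\<close>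

locale padic_absval =
  fixes p :: nat and T :: "'a::complete_nonarch_field itself"
  assumes prime_p: "prime p" and absval_p: "absval (of_nat p :: 'a) = 1 / real p"
begin

abbreviation "rho \<equiv> padic_exp_radius p"

section \<open>Absolute values of integers and factorials\<close>

lemma p_ge_2: "2 \<le> p"
  using prime_p by (rule prime_ge_2_nat)

lemma rho_pos [simp]: "0 < rho"
  using p_ge_2 by (simp add: padic_exp_radius_def)

lemma rho_nonneg [simp]: "0 \<le> rho"
  using rho_pos by linarith

lemma rho_power: "rho ^ (p - 1) = 1 / real p"
proof -
  have "rho ^ (p - 1) = rho powr (real p - 1)"
    using p_ge_2 by (simp add: of_nat_diff flip: powr_realpow)
  also have "\<dots> = real p powr - 1"
    unfolding padic_exp_radius_def powr_powr using p_ge_2 by simp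
  finally show ?thesis
    using p_ge_2 by (simp add: powr_minus_divide)
qed

lemma rho_less_1: "rho < 1"
  using p_ge_2 by (simp add: padic_exp_radius_def powr_less_one)

text \<open>In a Bezout relation \<open>a n + b p = 1\<close> the term \<open>b p\<close> has
  absolute value below 1, so \<open>a n\<close> has absolute value 1; as \<open>a\<close> is an
  integer, this forces the same for \<open>n\<close>.\<close>

lemma absval_of_nat_coprime:
  assumes "\<not> p dvd n"
  shows "absval (of_nat n :: 'a) = 1"
proof -
  have "coprime n p"
    using assms prime_p prime_imp_coprime coprime_commute by blast
  then have "gcd (int n) (int p) = 1"
    by simp
  then obtain a b where "a * int n + b * int p = 1"
    using bezout_int[of "int n" "int p"] by auto
  then have "(of_int a * of_nat n + of_int b * of_nat p :: 'a) = 1"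
    by (metis of_int_1 of_int_add of_int_mult of_int_of_nat_eq)
  moreover have "absval (of_int b * of_nat p :: 'a) < 1"
  proof -
    have "absval (of_int b * of_nat p :: 'a) \<le> 1 * (1 / real p)"
      unfolding absval_mult absval_p by (intro mult_right_mono) auto
    also have "\<dots> < 1"
      using p_ge_2 by simp
    finally show ?thesis .
  qed
  ultimately have "absval (of_int a * of_nat n :: 'a) = 1"
    using absval_add_dominant[of "- (of_int b * of_nat p)" "1::'a"] by (simp add: eq_diff_eq[symmetric])
  then have "1 \<le> 1 * absval (of_nat n :: 'a)"
    unfolding absval_mult by (metis absval_nonneg absval_of_int_le_1 mult_right_mono)
  then show ?thesis
    by (simp add: antisym)
qed

text \<open>Stripping a factor \<open>p\<close> scales both sides by \<open>1 / p\<close>; once none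
  is left, the absolute value is 1.\<close>

lemma absval_of_nat_ge:
  assumes "n > 0"
  shows "1 / real n \<le> absval (of_nat n :: 'a)"
  using assms
proof (induction n rule: less_induct)
  case (less n)
  show ?case
  proof (cases "p dvd n")
    case True
    then obtain m where m: "n = p * m" ..
    with less.prems p_ge_2 have "m > 0" "m < n" by auto
    then have "1 / real p * (1 / real m) \<le> 1 / real p * absval (of_nat m :: 'a)"
      by (intro mult_left_mono less.IH) auto
    then show ?thesis
      by (simp add: m absval_mult absval_p)
  next
    case False
    then show ?thesis
      using less.prems by (simp add: absval_of_nat_coprime)
  qed
qed

lemma absval_fact_Suc_coprime:
  assumes "\<not> p dvd Suc n"
  shows "absval (fact (Suc n) :: 'a) = absval (fact n :: 'a)"
  unfolding fact_Suc absval_mult using absval_of_nat_coprime[OF assms] by simp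

text \<open>Only the multiples of \<open>p\<close> among the factors matter, and their product is
  \<open>p ^ m * fact m\<close>.\<close>

lemma absval_fact_mult_add:
  assumes "r < p"
  shows "absval (fact (p * m + r) :: 'a) = absval (fact m :: 'a) / real p ^ m"
  using assms
proof (induction m arbitrary: r)
  case (Suc m)
  define N where "N = p * m + (p - 1)"
  have N: "Suc N = p * Suc m"
    using p_ge_2 by (simp add: N_def)
  have "absval (fact N :: 'a) = absval (fact m :: 'a) / real p ^ m"
    unfolding N_def using p_ge_2 by (intro Suc.IH) auto
  moreover have "(fact (Suc N) :: 'a) = of_nat p * of_nat (Suc m) * fact N"
    by (metis N fact_Suc of_nat_mult)
  ultimately have base: "absval (fact (p * Suc m) :: 'a) = absval (fact (Suc m) :: 'a) / real p ^ Suc m"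
    unfolding N[symmetric] by (simp add: absval_mult absval_p del: of_nat_Suc)
  show ?case
    using Suc.prems
  proof (induction r)
    case (Suc r)
    have "\<not> p dvd Suc r"
      using Suc.prems by (meson nat_dvd_not_less zero_less_Suc)
    then have "\<not> p dvd Suc (p * Suc m + r)"
      by (metis add_Suc_right dvd_add_right_iff dvd_triv_left)
    from absval_fact_Suc_coprime[OF this] show ?case
      using Suc unfolding add_Suc_right by simp
  qed (use base in simp)
next
  case 0
  then show ?case
  proof (induction r)
    case (Suc r)
    then have "\<not> p dvd Suc r"
      by (meson nat_dvd_not_less zero_less_Suc)
    from absval_fact_Suc_coprime[OF this] Suc show ?case
      by simp
  qed simp
qed

text \<open>Legendre's bound: \<open>p\<close> divides \<open>n!\<close> at most
  \<open>(n - 1) / (p - 1)\<close> times. With \<open>m = n div p > 0\<close>, the factor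
  \<open>1 / real p ^ m\<close> is \<open>rho ^ ((p - 1) * m)\<close>, and
  \<open>(p - 1) * m + (m - 1) = p * m - 1\<close> is at most \<open>n - 1\<close>.\<close>

lemma absval_fact_ge:
  assumes "n > 0"
  shows "rho ^ (n - 1) \<le> absval (fact n :: 'a)"
  using assms
proof (induction n rule: less_induct)
  case (less n)
  define m r where "m = n div p" and "r = n mod p"
  have n: "n = p * m + r" and r: "r < p"
    using p_ge_2 by (simp_all add: m_def r_def)
  show ?case
  proof (cases "m = 0")
    case True
    then have "absval (fact n :: 'a) = 1"
      using absval_fact_mult_add[OF r, of 0] n by simp
    then show ?thesis
      using rho_less_1 by (simp add: power_le_one)
  next
    case False
    then have "m < n"
      unfolding m_def using p_ge_2 less.prems by (intro div_less_dividend) auto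
    have "(p - 1) * m + m = p * m"
      using p_ge_2 by (cases p) auto
    then have "n - 1 \<ge> (p - 1) * m + (m - 1)"
      using False n by arith
    then have "rho ^ (n - 1) \<le> rho ^ ((p - 1) * m + (m - 1))"
      using rho_less_1 by (intro power_decreasing) auto
    also have "\<dots> = rho ^ (m - 1) / real p ^ m"
      by (simp only: power_add power_mult rho_power power_divide) simp
    also have "\<dots> \<le> absval (fact m :: 'a) / real p ^ m"
      using False \<open>m < n\<close> by (intro divide_right_mono less.IH) auto
    finally show ?thesis
      by (simp add: n absval_fact_mult_add[OF r])
  qed
qed

text \<open>The factor \<open>absval z\<close> is kept apart because it yields bounds by
  \<open>absval z\<close> for the logarithm and for \<open>padic_exp z - 1\<close>. The coarser
  variant that follows is purely geometric and covers \<open>n = 0\<close>.\<close>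

lemma absval_power_div_fact_le:
  assumes "n > 0"
  shows "absval ((z::'a) ^ n / fact n) \<le> absval z * (absval z / rho) ^ (n - 1)"
proof -
  have "absval (z ^ n / fact n) \<le> absval z ^ n / rho ^ (n - 1)"
    unfolding absval_divide absval_power
    using absval_fact_ge[OF assms] by (intro divide_left_mono) auto
  also have "\<dots> = absval z * (absval z / rho) ^ (n - 1)"
    using assms by (cases n) (auto simp: power_divide)
  finally show ?thesis .
qed

lemma absval_power_div_fact_le_power: "absval ((z::'a) ^ n / fact n) \<le> (absval z / rho) ^ n"
proof (cases n)
  case (Suc m)
  have "absval z * (absval z / rho) ^ m \<le> absval z / rho * (absval z / rho) ^ m"
    using rho_less_1 by (intro mult_right_mono) (auto simp: le_divide_eq mult_left_le)
  then show ?thesis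
    using absval_power_div_fact_le[of n z] Suc by simp
qed simp

text \<open>Since \<open>n\<close> divides \<open>fact n\<close>, the absolute value of
  \<open>fact n\<close> is at most that of \<open>n\<close>, and the bound for the exponential
  series carries over.\<close>

lemma absval_power_div_of_nat_le:
  assumes "n > 0"
  shows "absval ((z::'a) ^ n / of_nat n) \<le> absval z * (absval z / rho) ^ (n - 1)"
proof -
  have "fact n = of_nat n * (fact (n - 1) :: 'a)"
    using assms by (simp add: fact_reduce)
  moreover have "absval (fact (n - 1) :: 'a) \<le> 1"
    by (metis absval_of_nat_le_1 of_nat_fact)
  ultimately have "absval (fact n :: 'a) \<le> absval (of_nat n :: 'a)"
    by (simp add: absval_mult mult_left_le)
  then have "absval (z ^ n / of_nat n) \<le> absval (z ^ n / fact n)"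
    unfolding absval_divide using assms by (intro divide_left_mono) auto
  then show ?thesis
    using absval_power_div_fact_le[OF assms, of z] by linarith
qed

section \<open>The series of the logarithm and of the exponential\<close>

lemma geometric_null:
  assumes "absval (z::'a) < rho"
  shows "(\<lambda>n. C * (absval z / rho) ^ n) \<longlonglongrightarrow> 0"
  using assms by (intro tendsto_mult_right_zero LIMSEQ_realpow_zero) auto

lemma geometric_le:
  assumes "absval (z::'a) < rho"
  shows "absval z * (absval z / rho) ^ n \<le> absval z"
  using assms by (intro mult_left_le power_le_one) auto

lemma absval_fps_ln_term:
  assumes "n > 0"
  shows "absval (fps_ln 1 $ n * (z::'a) ^ n) = absval (z ^ n / of_nat n)"
  using assms by (simp add: fps_ln_nth absval_mult absval_divide)

text \<open>The leading \<open>rho\<close> becomes \<open>rho ^ k\<close> for the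
  \<open>k\<close>-th power of the logarithm and then cancels the denominator in the bound for
  \<open>fps_exp c $ k\<close>.\<close>

lemma absval_fps_ln_term_le: "absval (fps_ln 1 $ n * (z::'a) ^ n) \<le> rho * (absval z / rho) ^ n"
proof (cases n)
  case (Suc m)
  have "rho * (absval z / rho) ^ n = absval z * (absval z / rho) ^ m"
    unfolding Suc using rho_pos by (simp del: rho_pos)
  then show ?thesis
    using absval_power_div_of_nat_le[of n z] absval_fps_ln_term[of n z] Suc by simp
qed simp

lemma has_sum_padic_log:
  assumes "absval (z::'a) < rho"
  shows "((\<lambda>n. fps_ln 1 $ n * z ^ n) has_sum padic_log (1 + z)) UNIV"
proof -
  let ?f = "\<lambda>n. fps_ln 1 $ n * z ^ n"
  obtain s where s: "(?f has_sum s) UNIV"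
    using summable_on_null_sequence[OF absval_fps_ln_term_le geometric_null[OF assms]]
    by (auto simp: summable_on_def)
  \<comment> \<open>\<open>fps_ln 1\<close> has no constant term, so index 0 may be dropped; the
    series defining \<open>padic_log\<close> runs over the shifted index.\<close>
  then have "(?f has_sum s) (range Suc)"
    by (rule has_sum_cong_neutral[THEN iffD1, rotated -1])
      (auto simp: image_iff, (metis fps_ln_0 gr0I not0_implies_Suc)+)
  then have "((?f \<circ> Suc) has_sum s) UNIV"
    by (subst (asm) has_sum_reindex) auto
  then have "(\<lambda>n. (-1) ^ n * ((1 + z) - 1) ^ Suc n / of_nat (Suc n)) sums s"
    by (auto dest!: has_sum_imp_sums simp: fps_ln_nth o_def)
  then have "padic_log (1 + z) = s"
    unfolding padic_log_def by (rule sums_unique[symmetric])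
  then show ?thesis using s by simp
qed

lemma absval_padic_log_le:
  assumes "absval (z::'a) < rho"
  shows "absval (padic_log (1 + z)) \<le> absval z"
proof (rule absval_has_sum_le[OF has_sum_padic_log[OF assms]])
  fix n
  show "absval (fps_ln 1 $ n * z ^ n) \<le> absval z"
    using absval_power_div_of_nat_le[of n z] absval_fps_ln_term[of n z]
      geometric_le[OF assms, of "n - 1"]
    by (cases "n = 0") auto
qed simp

lemma has_sum_padic_exp:
  assumes "absval (z::'a) < rho"
  shows "((\<lambda>n. z ^ n / fact n) has_sum padic_exp z) UNIV"
proof -
  obtain s where s: "((\<lambda>n. z ^ n / fact n) has_sum s) UNIV"
    using summable_on_null_sequence[of "\<lambda>n. z ^ n / fact n", OF absval_power_div_fact_le_power]
      geometric_null[OF assms, of 1]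
    by (auto simp: summable_on_def)
  then have "padic_exp z = s"
    unfolding padic_exp_def by (intro sums_unique[symmetric] has_sum_imp_sums)
  then show ?thesis using s by simp
qed

lemma padic_exp_0 [simp]: "padic_exp (0::'a) = 1"
proof -
  have "((\<lambda>n. (0::'a) ^ n / fact n) has_sum 1) UNIV"
    by (rule has_sum_finite_neutralI[where B = "{0}"]) auto
  then show ?thesis
    using has_sum_padic_exp[of 0] has_sum_unique by fastforce
qed

lemma absval_padic_exp_minus_1_le:
  assumes "absval (z::'a) < rho"
  shows "absval (padic_exp z - 1) \<le> absval z"
proof -
  \<comment> \<open>The extra -1 at index 0 removes the constant term; all other terms are at most
    \<open>absval z\<close>.\<close>
  have "((\<lambda>n. z ^ n / fact n + (if n = 0 then - 1 else 0)) has_sum padic_exp z + (- 1)) UNIV"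
    by (intro has_sum_add has_sum_padic_exp assms has_sum_finite_neutralI[where B = "{0}"]) auto
  then have "absval (padic_exp z + (- 1)) \<le> absval z"
  proof (rule absval_has_sum_le)
    fix n
    show "absval (z ^ n / fact n + (if n = 0 then - 1 else 0)) \<le> absval z"
      using absval_power_div_fact_le[of n z] geometric_le[OF assms, of "n - 1"]
      by (cases "n = 0") auto
  qed simp
  then show ?thesis by simp
qed

lemma padic_exp_add:
  assumes "absval (x::'a) < rho" "absval y < rho"
  shows "padic_exp (x + y) = padic_exp x * padic_exp y"
proof -
  have null: "(\<lambda>n. absval ((z::'a) ^ n / fact n)) \<longlonglongrightarrow> 0" if "absval z < rho" for z
    by (rule tendsto_sandwich[OF _ _ tendsto_const[of 0], where h = "\<lambda>n. (absval z / rho) ^ n"])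
      (use that absval_power_div_fact_le_power geometric_null[OF that, of 1] in auto)
  have "(\<Sum>i=0..n. x ^ i / fact i * (y ^ (n - i) / fact (n - i))) = (x + y) ^ n / fact n" for n
    using fps_exp_add_mult[of x y, THEN arg_cong, of "\<lambda>f. f $ n"] by (simp add: fps_mult_nth)
  then have "((\<lambda>n. (x + y) ^ n / fact n) has_sum padic_exp x * padic_exp y) UNIV"
    using has_sum_Cauchy_product_nonarch[OF has_sum_padic_exp[OF assms(1)] null[OF assms(1)]
        has_sum_padic_exp[OF assms(2)] null[OF assms(2)]] by simp
  moreover have "absval (x + y) < rho"
    using absval_add[of x y] assms by auto
  ultimately show ?thesis
    using has_sum_padic_exp has_sum_unique by blast
qed

lemma has_sum_degenerate_exp:
  assumes a: "absval (a::'a) \<le> 1" and t: "absval t < rho" and lt: "absval (lam * t) < rho"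
    and lam: "lam \<noteq> 0"
  shows "((\<lambda>m. (\<Prod>j<m. a - of_nat j * lam) * t ^ m / fact m) has_sum degenerate_exp lam a t) UNIV"
proof -
  define c w where "c = a / lam" and "w = padic_log (1 + lam * t)"
  define \<sigma> \<theta> where "\<sigma> = absval t / rho" and "\<theta> = absval (lam * t) / rho"
  have range: "0 \<le> \<sigma>" "\<sigma> < 1" "0 \<le> \<theta>" "\<theta> < 1"
    using t lt by (auto simp: \<sigma>_def \<theta>_def)
  \<comment> \<open>\<open>c\<close> may be large, but its denominator \<open>lam\<close> cancels
    against the bound for the logarithm, so \<open>c * w\<close> lies in the disc of convergence
    because \<open>t\<close> does.\<close>
  have "absval (c * w) \<le> absval c * absval (lam * t)"
    unfolding w_def absval_mult[of c] by (intro mult_left_mono absval_padic_log_le lt) auto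
  also have "\<dots> = absval a * absval t"
    using lam by (simp add: c_def absval_mult absval_divide)
  also have "\<dots> \<le> 1 * absval t"
    using a by (intro mult_right_mono) auto
  finally have cw: "absval (c * w) < rho"
    using t by simp
  note ln = has_sum_fps_nth_power[OF absval_fps_ln_term_le _ _ _ has_sum_padic_log[OF lt], folded w_def]
  have "((\<lambda>n. (fps_exp c oo fps_ln 1) $ n * (lam * t) ^ n) has_sum padic_exp (c * w)) UNIV"
  proof (rule has_sum_fps_compose)
    show "((\<lambda>n. (fps_ln 1 ^ k) $ n * (lam * t) ^ n) has_sum w ^ k) UNIV" for k
      by (rule ln(2)) (use range in \<open>auto simp: \<theta>_def\<close>)
    show "((\<lambda>k. fps_exp c $ k * w ^ k) has_sum padic_exp (c * w)) UNIV"
      using has_sum_padic_exp[OF cw] by (simp add: power_mult_distrib)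
    show "absval (fps_exp c $ k * (fps_ln 1 ^ k) $ n * (lam * t) ^ n) \<le> max \<sigma> \<theta> ^ n"
      if "k \<le> n" for k n
    proof -
      have 1: "absval (fps_exp c $ k) \<le> (absval c / rho) ^ k"
        using absval_power_div_fact_le_power[of c k] by simp
      have 2: "absval ((fps_ln 1 ^ k) $ n * (lam * t) ^ n) \<le> rho ^ k * \<theta> ^ n"
        unfolding \<theta>_def by (rule ln(1)) (use range in \<open>auto simp: \<theta>_def\<close>)
      have "absval (fps_exp c $ k * ((fps_ln 1 ^ k) $ n * (lam * t) ^ n))
          \<le> (absval c / rho) ^ k * (rho ^ k * \<theta> ^ n)"
        unfolding absval_mult[of "fps_exp c $ k"] by (rule mult_mono[OF 1 2]) auto
      \<comment> \<open>The powers of \<open>rho\<close> cancel, and \<open>k \<le> n\<close> allows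
        \<open>\<theta> ^ k\<close> to be split off; then
        \<open>absval c * \<theta> \<le> \<sigma>\<close>, because \<open>lam\<close> cancels
        again.\<close>
      also have "\<dots> = (absval c * \<theta>) ^ k * \<theta> ^ (n - k)"
        using that rho_pos by (simp add: power_divide power_mult_distrib mult_ac del: rho_pos flip: power_add)
      also have "\<dots> \<le> \<sigma> ^ k * \<theta> ^ (n - k)"
      proof (intro mult_right_mono power_mono)
        have "absval c * \<theta> = absval a * absval t / rho"
          using lam by (simp add: \<theta>_def c_def absval_mult absval_divide)
        also have "\<dots> \<le> 1 * absval t / rho"
          using a by (intro divide_right_mono mult_right_mono) auto
        finally show "absval c * \<theta> \<le> \<sigma>" by (simp add: \<sigma>_def)
      qed (use range in auto)
      also have "\<dots> \<le> max \<sigma> \<theta> ^ k * max \<sigma> \<theta> ^ (n - k)"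
        using range by (intro mult_mono power_mono) auto
      also have "\<dots> = max \<sigma> \<theta> ^ n"
        using that by (simp flip: power_add)
      finally show ?thesis by (simp add: mult.assoc)
    qed
  qed (use range in auto)
  \<comment> \<open>Distributing \<open>lam ^ m\<close> over the factors of the binomial coefficient
    of \<open>c\<close> turns step 1 into step \<open>lam\<close>.\<close>
  moreover have "(fps_exp c oo fps_ln 1) $ m * (lam * t) ^ m
      = (\<Prod>j<m. a - of_nat j * lam) * t ^ m / fact m" for m
  proof -
    have "(\<Prod>j<m. c - of_nat j) * lam ^ m = (\<Prod>j<m. (c - of_nat j) * lam)"
      by (simp add: prod.distrib)
    also have "\<dots> = (\<Prod>j<m. a - of_nat j * lam)"
      using lam by (simp add: c_def left_diff_distrib)
    finally show ?thesis
      by (simp add: fps_exp_compose_ln gbinomial_prod_rev power_mult_distrib atLeast0LessThan)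
  qed
  ultimately show ?thesis
    unfolding degenerate_exp_def c_def w_def by simp
qed

end

section \<open>Means of polynomials in the q-numbers\<close>

text \<open>The geometric sum expresses \<open>(1 - q ^ n) / (1 - q)\<close> without a division, so
  that \<open>q = 1\<close> is included.\<close>

definition q_nat :: "'a::comm_ring_1 \<Rightarrow> nat \<Rightarrow> 'a" where
  "q_nat q n = (\<Sum>i<n. q ^ i)"

lemma q_nat_0 [simp]: "q_nat q 0 = 0"
  by (simp add: q_nat_def)

lemma q_nat_Suc: "q_nat q (Suc n) = q_nat q n + q ^ n"
  by (simp add: q_nat_def)

lemma q_nat_Suc_shift: "q_nat q (Suc n) = 1 + q * q_nat q n"
  unfolding q_nat_def by (subst sum.lessThan_Suc_shift) (simp add: sum_distrib_left)

lemma q_nat_mult: "(q - 1) * q_nat q n = q ^ n - 1"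
  unfolding q_nat_def by (rule power_diff_1_eq[symmetric])

text \<open>This is \<open>((1 + h) ^ n - 1) / h\<close> expanded. The term \<open>j = 0\<close> is
  \<open>n\<close>; \<open>absval_q_nat\<close> treats the others as a perturbation.\<close>

lemma q_nat_1_add: "q_nat (1 + h) n = (\<Sum>j<n. of_nat (n choose Suc j) * h ^ j)"
proof (induction n)
  case (Suc n)
  have "(1 + h) ^ n = (\<Sum>j<Suc n. of_nat (n choose j) * h ^ j)"
    using binomial_ring[of h 1 n] by (simp add: lessThan_Suc_atMost add.commute)
  moreover have "q_nat (1 + h) n = (\<Sum>j<Suc n. of_nat (n choose Suc j) * h ^ j)"
    using Suc by (simp add: binomial_eq_0)
  ultimately show ?case
    by (simp only: q_nat_Suc flip: sum.distrib) (simp add: distrib_right add.commute)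
qed simp

definition q_nat_falling :: "'a::comm_ring_1 \<Rightarrow> nat \<Rightarrow> nat \<Rightarrow> 'a" where
  "q_nat_falling q k y = (\<Prod>i<k. q_nat q y - q_nat q i)"

text \<open>The sum telescopes: from \<open>n\<close> to \<open>Suc n\<close>,
  \<open>q_nat_falling q (Suc k)\<close> grows by
  \<open>q_nat q (Suc k) * q_nat_falling q k n * q ^ n\<close>.\<close>

lemma sum_q_nat_falling:
  "q_nat q (Suc k) * (\<Sum>y<n. q_nat_falling q k y * q ^ y) = q_nat_falling q (Suc k) n"
proof (induction n)
  case 0
  show ?case
    unfolding q_nat_falling_def by (subst prod.lessThan_Suc_shift) simp
next
  case (Suc n)
  \<comment> \<open>The factor \<open>i = 0\<close> is \<open>q_nat q (Suc n)\<close>; in the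
    others, lowering both arguments by one produces a factor \<open>q\<close>.\<close>
  have "q_nat_falling q (Suc k) (Suc n) = q_nat q (Suc n) * (\<Prod>i<k. q * (q_nat q n - q_nat q i))"
    unfolding q_nat_falling_def
    by (subst prod.lessThan_Suc_shift) (simp add: q_nat_Suc_shift right_diff_distrib)
  also have "\<dots> = q ^ k * q_nat q (Suc n) * q_nat_falling q k n"
    by (simp add: q_nat_falling_def prod.distrib)
  also have "q ^ k * q_nat q (Suc n) = (q_nat q n - q_nat q k) + q_nat q (Suc k) * q ^ n"
  proof -
    \<comment> \<open>Both sides equal \<open>(q - 1) * q_nat q k * q_nat q n\<close>.\<close>
    have "(q ^ k - 1) * q_nat q n = q_nat q k * (q ^ n - 1)"
      by (simp add: q_nat_mult[symmetric])
    then show ?thesis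
      by (simp add: q_nat_Suc algebra_simps)
  qed
  also have "\<dots> * q_nat_falling q k n
      = q_nat_falling q (Suc k) n + q_nat q (Suc k) * (q_nat_falling q k n * q ^ n)"
    by (simp add: q_nat_falling_def algebra_simps)
  finally show ?case
    using Suc by (simp add: distrib_left)
qed

text \<open>At \<open>n = p ^ N\<close> these are the approximants whose limit defines
  \<open>q_integral\<close>.\<close>

definition q_mean :: "'a::field \<Rightarrow> (nat \<Rightarrow> 'a) \<Rightarrow> nat \<Rightarrow> 'a" where
  "q_mean q f n = (\<Sum>y<n. f y * q ^ y) / q_nat q n"

lemma q_mean_add: "q_mean q (\<lambda>y. f y + g y) n = q_mean q f n + q_mean q g n"
  by (simp add: q_mean_def distrib_right sum.distrib add_divide_distrib)

lemma q_mean_cmult: "q_mean q (\<lambda>y. c * f y) n = c * q_mean q f n"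
  by (simp add: q_mean_def sum_distrib_left mult_ac)

lemma q_mean_sum: "q_mean q (\<lambda>y. \<Sum>i\<in>A. f i y) n = (\<Sum>i\<in>A. q_mean q (f i) n)"
  unfolding q_mean_def sum_distrib_right sum_divide_distrib[symmetric] by (subst sum.swap) simp

lemma sums_q_mean:
  fixes q :: "'a::complete_nonarch_field"
  assumes "\<And>y. (\<lambda>m. f m y) sums g y"
  shows "(\<lambda>m. q_mean q (f m) n) sums q_mean q g n"
  unfolding q_mean_def divide_inverse sums_def
  by (subst sum_distrib_right[symmetric], subst sum.swap, subst sum_distrib_right[symmetric])
    (intro tendsto_intros assms[unfolded sums_def])

section \<open>Expansions of products with step \<open>lam\<close>\<close>

lemma prod_step_Vandermonde:
  fixes a b lam :: "'a::field_char_0"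
  assumes "lam \<noteq> 0"
  shows "(\<Prod>j<n. a + b - of_nat j * lam) = (\<Sum>k=0..n. of_nat (n choose k) *
    (\<Prod>j<n - k. a - of_nat j * lam) * (\<Prod>j<k. b - of_nat j * lam))"
proof -
  \<comment> \<open>Scaling by \<open>- lam\<close> gives rising factorials, for which
    \<open>pochhammer_binomial_sum\<close> is the Vandermonde identity.\<close>
  have poch: "(\<Prod>j<m. c - of_nat j * lam) = (- lam) ^ m * pochhammer (- c / lam) m" for c m
  proof -
    have "(\<Prod>j<m. c - of_nat j * lam) = (\<Prod>j<m. (- lam) * (- c / lam + of_nat j))"
      using assms by (simp only: distrib_left) (simp add: mult.commute)
    then show ?thesis
      by (simp only: prod.distrib pochhammer_prod atLeast0LessThan) simp
  qed
  have "(\<Prod>j<n. a + b - of_nat j * lam) = (- lam) ^ n * pochhammer (- b / lam + - a / lam) n"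
    unfolding poch by (simp add: diff_divide_distrib algebra_simps)
  also have "\<dots> = (\<Sum>k\<le>n. (- lam) ^ n *
      (of_nat (n choose k) * pochhammer (- b / lam) k * pochhammer (- a / lam) (n - k)))"
    unfolding pochhammer_binomial_sum sum_distrib_left ..
  also have "\<dots> = (\<Sum>k=0..n. of_nat (n choose k) *
    (\<Prod>j<n - k. a - of_nat j * lam) * (\<Prod>j<k. b - of_nat j * lam))"
    unfolding poch
  proof (rule sum.cong)
    fix k assume "k \<in> {0..n}"
    then have "(- lam) ^ n = (- lam) ^ (n - k) * (- lam) ^ k"
      by (simp flip: power_add)
    then show "(- lam) ^ n *
      (of_nat (n choose k) * pochhammer (- b / lam) k * pochhammer (- a / lam) (n - k)) =
      of_nat (n choose k) * ((- lam) ^ (n - k) * pochhammer (- a / lam) (n - k)) *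
      ((- lam) ^ k * pochhammer (- b / lam) k)"
      by (simp only: mult_ac)
  qed (simp add: atLeast0AtMost)
  finally show ?thesis .
qed

text \<open>Multiplying the polynomial by the next factor \<open>X - k\<close> shifts its
  coefficients and subtracts \<open>k\<close> times the old ones; the induction step evaluates this
  recurrence at \<open>c\<close>.\<close>

lemma prod_diff_of_nat_stirling1:
  fixes c :: "'a::field_char_0"
  shows "(\<Prod>j<k. c - of_nat j) = (\<Sum>l=0..k. of_int (stirling1 k l) * c ^ l)"
proof (induction k)
  case (Suc k)
  define P where "P = (\<Prod>i<k. [:- int i, 1:])"
  have deg: "degree P \<le> k"
    unfolding P_def using degree_prod_sum_le[of "{..<k}" "\<lambda>i. [:- int i, 1:]"] by simp
  have coeff: "stirling1 (Suc k) l = coeff (pCons 0 P) l - int k * coeff P l" for l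
    by (simp add: stirling1_def P_def[symmetric])
  have "(\<Sum>l\<le>Suc k. of_int (stirling1 (Suc k) l) * c ^ l)
      = (\<Sum>l\<le>Suc k. of_int (coeff (pCons 0 P) l) * c ^ l)
        - of_nat k * (\<Sum>l\<le>Suc k. of_int (coeff P l) * c ^ l)"
    by (simp only: coeff of_int_diff of_int_mult of_int_of_nat_eq left_diff_distrib
        sum_subtractf sum_distrib_left mult.assoc)
  also have "(\<Sum>l\<le>Suc k. of_int (coeff (pCons 0 P) l) * c ^ l)
      = c * (\<Sum>l\<le>k. of_int (coeff P l) * c ^ l)"
    by (subst sum.atMost_Suc_shift) (simp add: sum_distrib_left mult_ac)
  \<comment> \<open>The index \<open>Suc k\<close> lies beyond the degree of
    \<open>P\<close>.\<close>
  also have "(\<Sum>l\<le>Suc k. of_int (coeff P l) * c ^ l) = (\<Sum>l\<le>k. of_int (coeff P l) * c ^ l)"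
    using deg by (simp add: coeff_eq_0)
  also have "(\<Sum>l\<le>k. of_int (coeff P l) * c ^ l) = (\<Prod>j<k. c - of_nat j)"
    using Suc by (simp add: stirling1_def P_def atLeast0AtMost)
  finally show ?case
    by (simp add: atLeast0AtMost algebra_simps)
qed (simp add: stirling1_def)

lemma prod_step_stirling1:
  fixes b lam :: "'a::field_char_0"
  assumes "lam \<noteq> 0"
  shows "(\<Prod>j<k. b - of_nat j * lam) = (\<Sum>l=0..k. of_int (stirling1 k l) * lam ^ (k - l) * b ^ l)"
proof -
  have "(\<Prod>j<k. b - of_nat j * lam) = (\<Prod>j<k. lam * (b / lam - of_nat j))"
    using assms by (simp add: right_diff_distrib mult.commute)
  also have "\<dots> = (\<Sum>l=0..k. lam ^ k * (of_int (stirling1 k l) * (b / lam) ^ l))"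
    by (simp only: prod.distrib prod_diff_of_nat_stirling1 sum_distrib_left) simp
  also have "\<dots> = (\<Sum>l=0..k. of_int (stirling1 k l) * lam ^ (k - l) * b ^ l)"
    using assms by (intro sum.cong) (auto simp: power_diff power_divide)
  finally show ?thesis .
qed

section \<open>Exchange of limit and series, and uniqueness of power series\<close>

lemma sums_tail_le:
  fixes f :: "nat \<Rightarrow> 'a::complete_nonarch_field"
  assumes "f sums s" "\<And>m. m \<ge> M \<Longrightarrow> absval (f m) \<le> e" "0 \<le> e"
  shows "absval (s - sum f {..<M}) \<le> e"
proof (rule absval_le_tendsto)
  show "(\<lambda>K. sum f {..<K} - sum f {..<M}) \<longlonglongrightarrow> s - sum f {..<M}"
    using assms(1) unfolding sums_def by (intro tendsto_intros)
  show "\<forall>\<^sub>F K in sequentially. absval (sum f {..<K} - sum f {..<M}) \<le> e"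
    using eventually_ge_at_top[of M]
  proof eventually_elim
    case (elim K)
    then have "sum f {..<K} - sum f {..<M} = sum f {M..<K}"
      by (metis atLeast0LessThan sum_diff_nat_ivl zero_le)
    then show ?case
      using assms(2,3) by (auto intro: absval_sum_le)
  qed
qed auto

text \<open>Dominated convergence with a bound that merely tends to 0: beyond some \<open>M\<close>
  all terms are small uniformly in \<open>N\<close>, hence so are the tails, and the first
  \<open>M\<close> terms converge one by one.\<close>

lemma tendsto_sums_dominated_nonarch:
  fixes c :: "nat \<Rightarrow> nat \<Rightarrow> 'a::complete_nonarch_field"
  assumes s: "\<And>N. c N sums s N" and l: "\<And>m. (\<lambda>N. c N m) \<longlonglongrightarrow> l m"
    and B: "\<And>N m. absval (c N m) \<le> B m" "B \<longlonglongrightarrow> 0"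
  shows "l sums lim s"
proof -
  have lB: "absval (l m) \<le> B m" for m
    using l[of m] by (rule absval_le_tendsto) (use B(1) in auto)
  obtain S where S: "l sums S"
    using summable_on_null_sequence[OF lB B(2)] by (auto simp: summable_on_def dest: has_sum_imp_sums)
  have "s \<longlonglongrightarrow> S"
  proof (rule metric_LIMSEQ_I)
    fix r :: real assume "r > 0"
    then have r2: "r / 2 > 0" by simp
    then obtain M where M: "\<And>m. m \<ge> M \<Longrightarrow> B m < r / 2"
      using order_tendstoD(2)[OF B(2)] unfolding eventually_sequentially by blast
    have "(\<lambda>N. sum (c N) {..<M}) \<longlonglongrightarrow> sum l {..<M}"
      by (intro tendsto_intros l)
    then obtain N0 where N0: "\<And>N. N \<ge> N0 \<Longrightarrow> dist (sum (c N) {..<M}) (sum l {..<M}) < r / 2"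
      using metric_LIMSEQ_D[OF _ r2] by blast
    have "dist (s N) S < r" if "N \<ge> N0" for N
    proof -
      have 1: "absval (s N - sum (c N) {..<M}) \<le> r / 2"
        using s
      proof (rule sums_tail_le)
        show "absval (c N m) \<le> r / 2" if "m \<ge> M" for m
          using B(1)[of N m] M[OF that] by linarith
      qed (use r2 in simp)
      have 2: "absval (S - sum l {..<M}) \<le> r / 2"
        using S
      proof (rule sums_tail_le)
        show "absval (l m) \<le> r / 2" if "m \<ge> M" for m
          using lB[of m] M[OF that] by linarith
      qed (use r2 in simp)
      have 3: "absval (sum (c N) {..<M} - sum l {..<M}) \<le> r / 2"
        using N0[OF that] by (simp add: dist_absval)
      \<comment> \<open>Three errors of at most \<open>r / 2\<close> combine to at most
        \<open>r / 2\<close>, not to their sum.\<close>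
      from absval_diff_le[OF absval_add_le[OF 1 3] 2] have "absval (s N - S) \<le> r / 2"
        by simp
      then show ?thesis
        using \<open>r > 0\<close> by (simp add: dist_absval)
    qed
    then show "\<exists>N0. \<forall>N\<ge>N0. dist (s N) S < r" by blast
  qed
  then have "lim s = S" by (rule limI)
  then show ?thesis using S by simp
qed

lemma sums_imp_tendsto_0:
  fixes f :: "nat \<Rightarrow> 'a::complete_nonarch_field"
  assumes "f sums s"
  shows "f \<longlonglongrightarrow> 0"
proof -
  have "(\<lambda>n. sum f {..<Suc n} - sum f {..<n}) \<longlonglongrightarrow> s - s"
    using assms unfolding sums_def by (intro tendsto_diff LIMSEQ_Suc)
  then show ?thesis by simp
qed

context padic_absval
begin

lemma powers_of_p_null: "(\<lambda>k. absval (of_nat (p ^ k) :: 'a)) \<longlonglongrightarrow> 0"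
  using p_ge_2 LIMSEQ_realpow_zero[of "1 / real p"] by (simp add: absval_p)

text \<open>The series of the differences \<open>e m\<close> has sum 0 near 0, and its terms at a
  fixed nonzero \<open>t\<close> are bounded by some \<open>B\<close>. If \<open>e\<close> vanishes
  below \<open>m\<close>, then at \<open>t * p ^ k\<close> the term \<open>m\<close> is balanced by
  a tail of order \<open>Suc m\<close>, so \<open>absval (e m * t ^ m)\<close> is at most
  \<open>B * absval (p ^ k)\<close> for every \<open>k\<close>.\<close>

lemma power_series_coeffs_unique:
  fixes c d :: "nat \<Rightarrow> 'a"
  assumes r: "r > 0"
    and eq: "\<And>t. absval t < r \<Longrightarrow> \<exists>s. (\<lambda>m. c m * t ^ m) sums s \<and> (\<lambda>m. d m * t ^ m) sums s"
  shows "c = d"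
proof
  define e where "e m = c m - d m" for m
  have e: "(\<lambda>m. e m * t ^ m) sums 0" if t: "absval t < r" for t
  proof -
    obtain s where "(\<lambda>m. c m * t ^ m) sums s" "(\<lambda>m. d m * t ^ m) sums s"
      using eq[OF t] by blast
    then have "(\<lambda>m. c m * t ^ m - d m * t ^ m) sums (s - s)"
      unfolding sums_def sum_subtractf by (intro tendsto_intros)
    then show ?thesis by (simp add: e_def left_diff_distrib)
  qed
  obtain K where "absval (of_nat (p ^ K) :: 'a) < r"
    using order_tendstoD(2)[OF powers_of_p_null r] by (auto simp: eventually_sequentially)
  define t :: 'a where "t = of_nat (p ^ K)"
  have t: "absval t < r" "t \<noteq> 0"
    using \<open>absval (of_nat (p ^ K) :: 'a) < r\<close> p_ge_2 by (auto simp: t_def)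
  have "(\<lambda>m. absval (e m * t ^ m)) \<longlonglongrightarrow> 0"
    using sums_imp_tendsto_0[OF e[OF t(1)], THEN iffD1[OF tendsto_absval_iff]] by simp
  then have "Bseq (\<lambda>m. absval (e m * t ^ m))"
    by (intro convergent_imp_Bseq convergentI)
  then obtain B where B: "\<And>m. absval (e m * t ^ m) \<le> B"
    by (elim BseqE) auto
  then have "0 \<le> B"
    using absval_nonneg order_trans by blast
  have "e m = 0" for m
  proof (induction m rule: less_induct)
    case (less m)
    have "absval (e m * t ^ m) \<le> B * absval (of_nat (p ^ k) :: 'a)" for k
    proof -
      define v :: 'a where "v = of_nat (p ^ k)"
      have v: "absval v \<le> 1" "v \<noteq> 0"
        unfolding v_def using p_ge_2 absval_of_nat_le_1 by (blast, simp)
      have "absval (t * v) \<le> absval t * 1"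
        unfolding absval_mult using v by (intro mult_left_mono) auto
      then have "(\<lambda>j. e j * (t * v) ^ j) sums 0"
        using t by (intro e) auto
      then have "absval (0 - (\<Sum>j<Suc m. e j * (t * v) ^ j)) \<le> B * absval v ^ Suc m"
      proof (rule sums_tail_le)
        fix j assume "j \<ge> Suc m"
        then have "absval v ^ j \<le> absval v ^ Suc m"
          using v by (intro power_decreasing) auto
        then have "absval (e j * t ^ j) * absval v ^ j \<le> B * absval v ^ Suc m"
          using B \<open>0 \<le> B\<close> by (intro mult_mono) auto
        then show "absval (e j * (t * v) ^ j) \<le> B * absval v ^ Suc m"
          by (simp add: absval_mult power_mult_distrib mult_ac)
      qed (use \<open>0 \<le> B\<close> in auto)
      moreover have "(\<Sum>j<Suc m. e j * (t * v) ^ j) = e m * (t * v) ^ m"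
        using less.IH by simp
      ultimately have "absval (e m * t ^ m) * absval v ^ m \<le> B * absval v * absval v ^ m"
        by (simp add: absval_mult power_mult_distrib mult_ac)
      then show ?thesis
        unfolding v_def[symmetric] using v by (subst (asm) mult_le_cancel_right_pos) auto
    qed
    moreover have "(\<lambda>k. B * absval (of_nat (p ^ k) :: 'a)) \<longlonglongrightarrow> 0"
      using powers_of_p_null by (rule tendsto_mult_right_zero)
    ultimately have "absval (e m * t ^ m) \<le> 0"
      by (intro tendsto_lowerbound[where F = sequentially]) auto
    then have "e m * t ^ m = 0"
      by (metis absval_eq_0_iff absval_nonneg antisym)
    then show ?case using t by simp
  qed
  then show "c m = d m" for m by (simp add: e_def)
qed

text \<open>In the expansion in powers of \<open>h = q - 1\<close> the term \<open>n\<close>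
  dominates: \<open>n choose (j + 2)\<close> is \<open>n / (j + 2)\<close> times an integer, and
  \<open>h ^ (j + 1) / (j + 2)\<close> has absolute value below 1.\<close>

lemma absval_q_nat:
  assumes "absval (q - 1 :: 'a) < rho"
  shows "absval (q_nat q n) = absval (of_nat n :: 'a)"
proof (cases n)
  case (Suc k)
  define h where "h = q - 1"
  have "absval h / rho < 1"
    using assms by (simp add: h_def)
  have tail: "absval (of_nat (n choose Suc (Suc j)) * h ^ Suc j)
      \<le> absval (of_nat n :: 'a) * (absval h / rho)" for j
  proof -
    have "Suc (Suc j) * (n choose Suc (Suc j)) = n * (k choose Suc j)"
      unfolding Suc by (rule Suc_times_binomial)
    then have "of_nat (Suc (Suc j)) * of_nat (n choose Suc (Suc j))
        = (of_nat n * of_nat (k choose Suc j) :: 'a)"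
      by (metis of_nat_mult)
    then have split: "of_nat (n choose Suc (Suc j)) * h ^ Suc j
        = of_nat n * (of_nat (k choose Suc j) * (h ^ Suc j / of_nat (Suc (Suc j))))"
      by (simp add: field_simps del: of_nat_Suc)
    have "absval (h ^ Suc j / of_nat (Suc (Suc j))) \<le> absval h / rho"
    proof (cases "h = 0")
      case False
      \<comment> \<open>The extra factor \<open>h\<close> makes the exponent equal to the
        denominator, as the bound for \<open>z ^ n / of_nat n\<close> requires; it is cancelled
        afterwards.\<close>
      have "absval h * absval (h ^ Suc j / of_nat (Suc (Suc j)))
          = absval (h ^ Suc (Suc j) / of_nat (Suc (Suc j)))"
        by (simp add: absval_mult absval_divide del: of_nat_Suc)
      also have "\<dots> \<le> absval h * (absval h / rho) ^ Suc j"
        using absval_power_div_of_nat_le[of "Suc (Suc j)" h] by simp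
      finally have "absval (h ^ Suc j / of_nat (Suc (Suc j))) \<le> (absval h / rho) ^ Suc j"
        using False by (subst (asm) mult_le_cancel_left_pos) auto
      also have "\<dots> \<le> (absval h / rho) ^ 1"
        using \<open>absval h / rho < 1\<close> by (intro power_decreasing) auto
      finally show ?thesis by simp
    qed simp
    then have "absval (of_nat (k choose Suc j) :: 'a) * absval (h ^ Suc j / of_nat (Suc (Suc j)))
        \<le> 1 * (absval h / rho)"
      by (intro mult_mono) auto
    from mult_left_mono[OF this absval_nonneg] show ?thesis
      unfolding split absval_mult by simp
  qed
  have "q_nat q n = of_nat n + (\<Sum>j<k. of_nat (n choose Suc (Suc j)) * h ^ Suc j)"
    using q_nat_1_add[of h n] unfolding Suc sum.lessThan_Suc_shift by (simp add: h_def)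
  moreover have "absval (\<Sum>j<k. of_nat (n choose Suc (Suc j)) * h ^ Suc j) < absval (of_nat n :: 'a)"
  proof -
    have "absval (\<Sum>j<k. of_nat (n choose Suc (Suc j)) * h ^ Suc j)
        \<le> absval (of_nat n :: 'a) * (absval h / rho)"
      by (intro absval_sum_le tail) auto
    also have "\<dots> < absval (of_nat n :: 'a) * 1"
      using \<open>absval h / rho < 1\<close> Suc by (intro mult_strict_left_mono) (auto simp del: of_nat_Suc)
    finally show ?thesis by simp
  qed
  ultimately show ?thesis
    using absval_add_dominant by metis
qed simp

end


section \<open>Convergence and growth of the means over powers of \<open>p\<close>\<close>

locale padic_q = padic_absval p T for p and T :: "'a::complete_nonarch_field itself" +
  fixes q :: 'a
  assumes q: "absval (q - 1) < rho"
begin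

lemma absval_q_nat_le_1 [simp]: "absval (q_nat q n) \<le> 1"
  using absval_q_nat[OF q] by simp

lemma q_nat_nonzero: "n > 0 \<Longrightarrow> q_nat q n \<noteq> 0"
  using absval_q_nat[OF q, of n] by (metis absval_eq_0_iff of_nat_eq_0_iff less_irrefl)

lemma q_nat_powers_of_p: "(\<lambda>N. q_nat q (p ^ N)) \<longlonglongrightarrow> 0"
  unfolding tendsto_absval_iff using powers_of_p_null by (simp add: absval_q_nat[OF q])

text \<open>The factor \<open>i = 0\<close> of \<open>q_nat_falling q (Suc k) n\<close> is
  \<open>q_nat q n\<close>, which cancels the denominator of the mean. So nothing blows up along
  \<open>n = p ^ N\<close>, where \<open>q_nat q n\<close> tends to 0.\<close>

lemma q_mean_falling:
  assumes "n > 0"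
  shows "q_mean q (q_nat_falling q k) n = (\<Prod>i<k. q_nat q n - q_nat q (Suc i)) / q_nat q (Suc k)"
proof -
  have "q_nat_falling q (Suc k) n = q_nat q n * (\<Prod>i<k. q_nat q n - q_nat q (Suc i))"
    unfolding q_nat_falling_def prod.lessThan_Suc_shift by simp
  then have "q_nat q (Suc k) * (\<Sum>y<n. q_nat_falling q k y * q ^ y)
      = q_nat q n * (\<Prod>i<k. q_nat q n - q_nat q (Suc i))"
    unfolding sum_q_nat_falling .
  then show ?thesis
    using q_nat_nonzero[of "Suc k"] q_nat_nonzero[OF assms]
    by (simp add: q_mean_def field_simps)
qed

text \<open>The factors \<open>a j + u * q_nat q y\<close> are absorbed one at a time by
  \<open>q_nat q y * q_nat_falling q k y = q_nat_falling q (Suc k) y + q_nat q k * q_nat_falling q k y\<close>,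
  so that only the telescoping means of \<open>q_nat_falling q k\<close> remain.\<close>

lemma q_mean_prod_linear:
  assumes a: "\<And>j. absval (a j) \<le> R" and u: "absval u \<le> R" and R: "1 \<le> R"
  shows "convergent (\<lambda>N. q_mean q (\<lambda>y. (\<Prod>j<m. a j + u * q_nat q y) * q_nat_falling q k y) (p ^ N))
    \<and> (\<forall>N. absval (q_mean q (\<lambda>y. (\<Prod>j<m. a j + u * q_nat q y) * q_nat_falling q k y) (p ^ N))
        \<le> R ^ m * real (Suc (m + k)))"
proof (induction m arbitrary: k)
  case 0
  have pos: "p ^ N > 0" for N
    using p_ge_2 by simp
  have "(\<lambda>N. (\<Prod>i<k. q_nat q (p ^ N) - q_nat q (Suc i)) * inverse (q_nat q (Suc k)))
      \<longlonglongrightarrow> (\<Prod>i<k. 0 - q_nat q (Suc i)) * inverse (q_nat q (Suc k))"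
  proof (intro tendsto_mult tendsto_const)
    show "(\<lambda>N. \<Prod>i<k. q_nat q (p ^ N) - q_nat q (Suc i)) \<longlonglongrightarrow> (\<Prod>i<k. 0 - q_nat q (Suc i))"
    proof (induction k)
      case (Suc k)
      show ?case
        unfolding prod.lessThan_Suc
        by (intro tendsto_mult Suc tendsto_diff tendsto_const q_nat_powers_of_p)
    qed simp
  qed
  then have "convergent (\<lambda>N. q_mean q (q_nat_falling q k) (p ^ N))"
    unfolding q_mean_falling[OF pos] divide_inverse by (rule convergentI)
  moreover have "absval (q_mean q (q_nat_falling q k) (p ^ N)) \<le> real (Suc k)" for N
  proof -
    have "absval (\<Prod>i<k. q_nat q (p ^ N) - q_nat q (Suc i)) \<le> 1"
      unfolding absval_prod by (intro prod_le_1) (auto intro: absval_diff_le)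
    \<comment> \<open>The remaining denominator \<open>q_nat q (Suc k)\<close> has the absolute
      value of \<open>Suc k\<close>; this is the source of the linear factor in the bound.\<close>
    moreover have "1 / absval (of_nat (Suc k) :: 'a) \<le> real (Suc k)"
      using absval_of_nat_ge[of "Suc k"]
      by (simp add: divide_le_eq mult.commute del: of_nat_Suc)
    ultimately show ?thesis
      unfolding q_mean_falling[OF pos] absval_divide absval_q_nat[OF q]
      using divide_right_mono[of _ 1 "absval (of_nat (Suc k) :: 'a)"] absval_nonneg order_trans by metis
  qed
  ultimately show ?case by simp
next
  case (Suc m)
  define G where "G m k y = (\<Prod>j<m. a j + u * q_nat q y) * q_nat_falling q k y" for m k y
  define c where "c = a m + u * q_nat q k"
  have "G (Suc m) k = (\<lambda>y. c * G m k y + u * G m (Suc k) y)"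
    by (rule ext) (simp add: G_def c_def q_nat_falling_def algebra_simps)
  then have step: "q_mean q (G (Suc m) k) n = c * q_mean q (G m k) n + u * q_mean q (G m (Suc k)) n" for n
    by (simp only: q_mean_add q_mean_cmult)
  have IH: "convergent (\<lambda>N. q_mean q (G m k) (p ^ N))"
    "absval (q_mean q (G m k) (p ^ N)) \<le> R ^ m * real (Suc (m + k))" for k N
    using Suc.IH[of k] by (simp_all add: G_def[abs_def])
  have "convergent (\<lambda>N. q_mean q (G (Suc m) k) (p ^ N))"
  proof -
    obtain L1 L2 where "(\<lambda>N. q_mean q (G m k) (p ^ N)) \<longlonglongrightarrow> L1"
      "(\<lambda>N. q_mean q (G m (Suc k)) (p ^ N)) \<longlonglongrightarrow> L2"
      using IH(1) unfolding convergent_def by blast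
    then show ?thesis
      unfolding step by (intro convergentI[of _ "c * L1 + u * L2"] tendsto_intros)
  qed
  moreover have "absval (q_mean q (G (Suc m) k) (p ^ N)) \<le> R ^ Suc m * real (Suc (Suc m + k))" for N
  proof -
    \<comment> \<open>Both summands of the recurrence fit under one bound, as
      \<open>k' \<le> Suc k\<close> gives \<open>m + k' \<le> Suc m + k\<close>.\<close>
    have le: "absval (w * q_mean q (G m k') (p ^ N)) \<le> R ^ Suc m * real (Suc (Suc m + k))"
      if "absval w \<le> R" "k' \<le> Suc k" for w k'
    proof -
      have "absval (w * q_mean q (G m k') (p ^ N)) \<le> R * (R ^ m * real (Suc (m + k')))"
        unfolding absval_mult using that IH(2) R by (intro mult_mono) auto
      also have "\<dots> \<le> R * (R ^ m * real (Suc (Suc m + k)))"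
        using that R by (intro mult_left_mono) auto
      finally show ?thesis by simp
    qed
    have "absval (u * q_nat q k) \<le> R * 1"
      unfolding absval_mult using u R by (intro mult_mono) auto
    then have "absval c \<le> R"
      unfolding c_def using a by (intro absval_add_le) auto
    then show ?thesis
      unfolding step using u by (intro absval_add_le le) auto
  qed
  ultimately show ?case
    unfolding G_def[abs_def] by blast
qed

section \<open>Powers of \<open>q\<close> with exponents in the unit ball, and q-numbers of
  sums\<close>

lemma padic_power_of_nat: "padic_power q (of_nat y) = q ^ y"
proof -
  define h where "h = q - 1"
  \<comment> \<open>With step 1, \<open>a = y\<close> and \<open>t = q - 1\<close>, the function
    \<open>degenerate_exp\<close> is \<open>padic_power q\<close> at \<open>y\<close>, and its
    series breaks off as the binomial expansion of \<open>(1 + h) ^ y\<close>.\<close>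
  have "((\<lambda>m. (\<Prod>j<m. of_nat y - of_nat j * 1) * h ^ m / fact m) has_sum degenerate_exp 1 (of_nat y) h) UNIV"
    using q by (intro has_sum_degenerate_exp) (auto simp: h_def)
  moreover have "(\<Prod>j<m. of_nat y - of_nat j * 1) * h ^ m / fact m = of_nat (y choose m) * h ^ m" for m
    by (simp add: binomial_gbinomial gbinomial_prod_rev atLeast0LessThan)
  ultimately have "((\<lambda>m. of_nat (y choose m) * h ^ m) has_sum padic_power q (of_nat y)) UNIV"
    by (simp add: degenerate_exp_def padic_power_def h_def)
  moreover have "((\<lambda>m. of_nat (y choose m) * h ^ m) has_sum q ^ y) UNIV"
  proof (rule has_sum_finite_neutralI[where B = "{..y}"])
    show "q ^ y = (\<Sum>m\<le>y. of_nat (y choose m) * h ^ m)"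
      using binomial_ring[of h 1 y] by (simp add: h_def)
  qed (auto simp: binomial_eq_0)
  ultimately show ?thesis
    by (rule has_sum_unique)
qed

lemma absval_mult_log_le:
  assumes "absval x \<le> 1"
  shows "absval (x * padic_log q) \<le> absval (q - 1)"
proof -
  have "absval x * absval (padic_log q) \<le> 1 * absval (q - 1)"
    using absval_padic_log_le[OF q] assms by (intro mult_mono) auto
  then show ?thesis by (simp add: absval_mult)
qed

lemma padic_power_add:
  assumes "absval x \<le> 1" "absval y \<le> 1"
  shows "padic_power q (x + y) = padic_power q x * padic_power q y"
  unfolding padic_power_def distrib_right
  using assms[THEN absval_mult_log_le] q by (intro padic_exp_add) auto

lemma padic_power_of_nat_mult:
  assumes "absval x \<le> 1"
  shows "padic_power q (of_nat l * x) = padic_power q x ^ l"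
proof (induction l)
  case (Suc l)
  have "absval (of_nat l :: 'a) * absval x \<le> 1 * 1"
    using assms by (intro mult_mono) auto
  then show ?case
    using padic_power_add[OF assms, of "of_nat l * x"] Suc
    by (simp add: distrib_right absval_mult)
qed (simp add: padic_power_def)

lemma absval_padic_power_minus_1_le:
  assumes "absval x \<le> 1"
  shows "absval (padic_power q x - 1) \<le> absval (q - 1)"
proof -
  note le = absval_mult_log_le[OF assms]
  then have "absval (x * padic_log q) < rho"
    using q by simp
  from absval_padic_exp_minus_1_le[OF this] le show ?thesis
    unfolding padic_power_def by linarith
qed

lemma absval_padic_power_le_1:
  assumes "absval x \<le> 1"
  shows "absval (padic_power q x) \<le> 1"
proof -
  have "absval (padic_power q x - 1) \<le> 1"
    using absval_padic_power_minus_1_le[OF assms] q rho_less_1 by linarith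
  then show ?thesis
    using absval_add_le[of "padic_power q x - 1" 1 1] by simp
qed

lemma absval_q_number_le_1:
  assumes "absval x \<le> 1"
  shows "absval (q_number q x) \<le> 1"
  using assms absval_padic_power_minus_1_le[OF assms]
  by (auto simp: q_number_def absval_divide absval_minus_commute divide_le_eq)

lemma q_number_add_of_nat:
  assumes "absval x \<le> 1"
  shows "q_number q (x + of_nat y) = q_number q x + padic_power q x * q_nat q y"
proof (cases "q = 1")
  case True
  \<comment> \<open>At \<open>q = 1\<close> the bound by \<open>absval (q - 1)\<close> leaves no
    other value.\<close>
  have "padic_power q x = 1"
    using absval_padic_power_minus_1_le[OF assms] True
    by (metis absval_0 absval_eq_0_iff absval_nonneg antisym diff_self eq_iff_diff_eq_0)
  then show ?thesis
    using True by (simp add: q_number_def q_nat_def)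
next
  case False
  have "padic_power q (x + of_nat y) = padic_power q x * q ^ y"
    using assms by (simp add: padic_power_add padic_power_of_nat)
  moreover have "1 - q ^ y = (1 - q) * q_nat q y"
    using q_nat_mult[of q y] by (simp add: algebra_simps)
  then have "q ^ y = 1 - (1 - q) * q_nat q y"
    by (simp add: algebra_simps)
  ultimately show ?thesis
    using False by (simp add: q_number_def field_simps)
qed

lemma q_number_of_nat: "q_number q (of_nat y) = q_nat q y"
proof -
  have "q_number q 0 = 0" "padic_power q 0 = 1"
    by (simp_all add: q_number_def padic_power_def)
  then show ?thesis
    using q_number_add_of_nat[of 0 y] by simp
qed

lemma q_integral_eq: "q_integral p q f = lim (\<lambda>N. q_mean q (\<lambda>y. f (of_nat y)) (p ^ N))"
  unfolding q_integral_def q_number_of_nat q_mean_def by simp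

lemma carlitz_beta_tendsto:
  "(\<lambda>N. q_mean q (\<lambda>y. q_nat q y ^ l) (p ^ N)) \<longlonglongrightarrow> carlitz_beta p q l"
  \<comment> \<open>Here all \<open>a j\<close> are 0, \<open>u = R = 1\<close> and
    \<open>k = 0\<close>, so the product is \<open>q_nat q y ^ l\<close>.\<close>
  using q_mean_prod_linear[of "\<lambda>_. 0" 1 1 l 0]
  by (simp add: q_nat_falling_def carlitz_beta_def q_integral_eq q_number_of_nat
      convergent_LIMSEQ_iff)

section \<open>The degenerate polynomials as limits of means\<close>

context
  fixes lam x :: 'a
  assumes lam: "lam \<noteq> 0" and x: "absval x \<le> 1"
begin

text \<open>As a function of \<open>y\<close>, this is the integrand whose q-integral turns out to
  be the \<open>m\<close>-th degenerate polynomial at \<open>x\<close>.\<close>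

definition step_falling :: "nat \<Rightarrow> nat \<Rightarrow> 'a" where
  "step_falling m y = (\<Prod>j<m. q_number q (x + of_nat y) - of_nat j * lam)"

lemma
  shows convergent_q_mean_step_falling: "convergent (\<lambda>N. q_mean q (step_falling m) (p ^ N))"
    and absval_q_mean_step_falling_le:
      "absval (q_mean q (step_falling m) (p ^ N)) \<le> max 1 (absval lam) ^ m * real (Suc m)"
proof -
  define a where "a j = q_number q x - of_nat j * lam" for j
  define u where "u = padic_power q x"
  \<comment> \<open>By \<open>q_number_add_of_nat\<close> every factor is linear in
    \<open>q_nat q y\<close>; \<open>q_nat_falling q 0 y\<close> is 1 and only brings the product
    into the required shape.\<close>
  have step: "step_falling m = (\<lambda>y. (\<Prod>j<m. a j + u * q_nat q y) * q_nat_falling q 0 y)"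
    by (rule ext)
      (simp add: step_falling_def a_def u_def q_nat_falling_def q_number_add_of_nat[OF x] algebra_simps)
  have "absval (of_nat j * lam) \<le> max 1 (absval lam)" for j
    using mult_right_mono[OF absval_of_nat_le_1[of j, where 'a = 'a], of "absval lam"]
    by (simp add: absval_mult)
  then have "absval (a j) \<le> max 1 (absval lam)" for j
    unfolding a_def using absval_q_number_le_1[OF x] by (intro absval_diff_le) auto
  moreover have "absval u \<le> max 1 (absval lam)"
    unfolding u_def using absval_padic_power_le_1[OF x] by simp
  ultimately show "convergent (\<lambda>N. q_mean q (step_falling m) (p ^ N))"
    and "absval (q_mean q (step_falling m) (p ^ N)) \<le> max 1 (absval lam) ^ m * real (Suc m)"
    unfolding step using q_mean_prod_linear[of a "max 1 (absval lam)" u m 0] by auto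
qed

lemma sums_q_integral_degenerate_exp:
  assumes t: "absval t < rho" "absval (lam * t) < rho"
  shows "(\<lambda>m. lim (\<lambda>N. q_mean q (step_falling m) (p ^ N)) * t ^ m / fact m) sums
    q_integral p q (\<lambda>y. degenerate_exp lam (q_number q (x + y)) t)"
  unfolding q_integral_eq
proof (rule tendsto_sums_dominated_nonarch)
  \<comment> \<open>\<open>\<eta>\<close> joins the geometric parts of the bounds for
    \<open>t ^ m / fact m\<close> and for the means. It is the larger of
    \<open>absval t / rho\<close> and \<open>absval (lam * t) / rho\<close>.\<close>
  define \<eta> where "\<eta> = absval t / rho * max 1 (absval lam)"
  have \<eta>: "0 \<le> \<eta>"
    by (simp add: \<eta>_def)
  have \<eta>1: "\<eta> < 1"
    using t by (cases "absval lam \<le> 1") (simp_all add: \<eta>_def max_def absval_mult mult.commute)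
  let ?c = "\<lambda>N m. t ^ m / fact m * q_mean q (step_falling m) (p ^ N)"
  show "?c N sums q_mean q (\<lambda>y. degenerate_exp lam (q_number q (x + of_nat y)) t) (p ^ N)" for N
  proof -
    have "absval (q_number q (x + of_nat y)) \<le> 1" for y
      using x by (intro absval_q_number_le_1 absval_add_le) auto
    from has_sum_imp_sums[OF has_sum_degenerate_exp[OF this t lam]]
    have "(\<lambda>m. t ^ m / fact m * step_falling m y) sums
        degenerate_exp lam (q_number q (x + of_nat y)) t" for y
      by (simp add: step_falling_def mult.commute)
    from sums_q_mean[OF this] show ?thesis
      unfolding q_mean_cmult .
  qed
  show "(\<lambda>N. ?c N m) \<longlonglongrightarrow> lim (\<lambda>N. q_mean q (step_falling m) (p ^ N)) * t ^ m / fact m" for m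
    using tendsto_mult[OF tendsto_const[of "t ^ m / fact m"]
        convergent_q_mean_step_falling[unfolded convergent_LIMSEQ_iff]]
    by (simp add: mult.commute)
  show "absval (?c N m) \<le> real (Suc m) * \<eta> ^ m" for N m
  proof -
    have "absval (?c N m) \<le> (absval t / rho) ^ m * (max 1 (absval lam) ^ m * real (Suc m))"
      unfolding absval_mult[of "t ^ m / fact m"]
      by (intro mult_mono absval_power_div_fact_le_power absval_q_mean_step_falling_le) auto
    then show ?thesis
      by (simp only: \<eta>_def power_mult_distrib mult_ac)
  qed
  have "(\<lambda>m. real m * \<eta> ^ m + \<eta> ^ m) \<longlonglongrightarrow> 0 + 0"
    using \<eta> \<eta>1 by (intro tendsto_add powser_times_n_limit_0 LIMSEQ_realpow_zero) auto
  then show "(\<lambda>m. real (Suc m) * \<eta> ^ m) \<longlonglongrightarrow> 0"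
    by (simp add: distrib_right add.commute)
qed

text \<open>The description in the definition is met by these limits, by
  \<open>sums_q_integral_degenerate_exp\<close>, and by no other sequence, since a power series on a
  disc determines its coefficients.\<close>

lemma degenerate_carlitz_beta_eq_lim:
  "degenerate_carlitz_beta p q lam n x = lim (\<lambda>N. q_mean q (step_falling n) (p ^ N))"
proof -
  define b where "b m = lim (\<lambda>N. q_mean q (step_falling m) (p ^ N))" for m
  \<comment> \<open>This radius makes both \<open>absval t\<close> and
    \<open>absval (lam * t)\<close> smaller than \<open>rho\<close>.\<close>
  define r where "r = min rho (rho / absval lam)"
  have r: "r > 0"
    using lam by (simp add: r_def)
  have range: "absval (lam * t) < rho \<and> absval t < rho" if "absval t < r" for t
    using that lam by (simp add: r_def absval_mult less_divide_eq mult.commute)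
  have "(THE b. \<forall>t. absval (lam * t) < rho \<and> absval t < rho \<longrightarrow>
      (\<lambda>m. b m * t ^ m / fact m) sums
        q_integral p q (\<lambda>y. degenerate_exp lam (q_number q (x + y)) t)) = b"
  proof (rule the_equality)
    show b: "\<forall>t. absval (lam * t) < rho \<and> absval t < rho \<longrightarrow>
      (\<lambda>m. b m * t ^ m / fact m) sums
        q_integral p q (\<lambda>y. degenerate_exp lam (q_number q (x + y)) t)"
      unfolding b_def using sums_q_integral_degenerate_exp by blast
    fix b'
    assume b': "\<forall>t. absval (lam * t) < rho \<and> absval t < rho \<longrightarrow>
      (\<lambda>m. b' m * t ^ m / fact m) sums
        q_integral p q (\<lambda>y. degenerate_exp lam (q_number q (x + y)) t)"
    have "(\<lambda>m. b' m / fact m) = (\<lambda>m. b m / fact m)"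
    proof (rule power_series_coeffs_unique[OF r])
      fix t :: 'a assume "absval t < r"
      from range[OF this] b b' show "\<exists>s. (\<lambda>m. b' m / fact m * t ^ m) sums s
          \<and> (\<lambda>m. b m / fact m * t ^ m) sums s"
        by (intro exI[of _ "q_integral p q (\<lambda>y. degenerate_exp lam (q_number q (x + y)) t)"]) simp
    qed
    then show "b' = b"
      by (simp add: fun_eq_iff)
  qed
  then show ?thesis
    unfolding degenerate_carlitz_beta_def b_def by simp
qed

lemma q_mean_step_falling_eq:
  "q_mean q (step_falling n) M =
    (\<Sum>k=0..n. \<Sum>l=0..k. of_nat (n choose k) * q_falling q lam x (n - k) * lam ^ (k - l)
       * padic_power q (of_nat l * x) * of_int (stirling1 k l) * q_mean q (\<lambda>y. q_nat q y ^ l) M)"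
proof -
  \<comment> \<open>Vandermonde splits \<open>[x] + q^x [y]\<close>. Only the product at
    \<open>padic_power q x * q_nat q y\<close> is then expanded by Stirling numbers; the one at
    \<open>q_number q x\<close> stays a \<open>q_falling\<close>.\<close>
  have "step_falling n = (\<lambda>y. \<Sum>k=0..n. \<Sum>l=0..k.
      (of_nat (n choose k) * q_falling q lam x (n - k) * lam ^ (k - l)
       * padic_power q (of_nat l * x) * of_int (stirling1 k l)) * q_nat q y ^ l)"
    by (rule ext)
      (simp only: step_falling_def q_number_add_of_nat[OF x] prod_step_Vandermonde[OF lam]
        prod_step_stirling1[OF lam, of "_ * _"] flip: q_falling_def,
       simp only: padic_power_of_nat_mult[OF x] power_mult_distrib sum_distrib_left,
       simp only: mult_ac)
  then show ?thesis
    by (simp only: q_mean_sum q_mean_cmult)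
qed

end

end

theorem theorem5:
  fixes p n :: nat and q lam x :: "'a::complete_nonarch_field"
  assumes "prime p"
    and "is_padic_complex TYPE('a) p"
    and "absval (q - 1) < real p powr (- 1 / (real p - 1))"
    and "lam \<noteq> 0"
    and "x \<in> padic_integers"
  shows "degenerate_carlitz_beta p q lam n x =
    (\<Sum>k=0..n. \<Sum>l=0..k. of_nat (n choose k) * q_falling q lam x (n - k) * lam ^ (k - l)
       * padic_power q (of_nat l * x) * of_int (stirling1 k l) * carlitz_beta p q l)"
proof -
  interpret padic_q p "TYPE('a)" q
    by unfold_locales (use assms in \<open>auto simp: is_padic_complex_def padic_exp_radius_def\<close>)
  have x: "absval x \<le> 1"
    using assms(5) by (simp add: padic_integers_def)
  show ?thesis
    \<comment> \<open>The expansion is exact for every mean, so only a finite double sum has to be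
      passed to the limit, term by term.\<close>
    unfolding degenerate_carlitz_beta_eq_lim[OF assms(4) x] q_mean_step_falling_eq[OF assms(4) x]
    by (intro limI tendsto_sum tendsto_mult tendsto_const carlitz_beta_tendsto)
qed

end
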